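(* Let $G$ be a finite simple graph and let $\mathcal{T}^\circ=\{T^\circ_1,\dots,T^\circ_n\}$ be a maximal tubing on $G$. Then the collection of cones \[ \mathcal{C}(G,\mathcal{T}^\circ)=\Bigl\{\mathbb{R}_{\ge 0}\{\mathbf{d}(\mathcal{T}^\circ,T)\,:\,T\in\mathcal{T}\}\;:\;\mathcal{T}\text{ a tubing on }G\Bigr\} \] is a complete simplicial fan in $\mathbb{R}^n$ which realizes the nested complex $\mathcal{N}(G)$; that is, for every tubing $\mathcal{T}$ the vectors $\mathbf{d}(\mathcal{T}^\circ,T)$, $T\in\mathcal{T}$, are linearly independent, these cones form a complete simplicial fan, and $\mathcal{T}\mapsto \mathbb{R}_{\ge0}\{\mathbf{d}(\mathcal{T}^\circ,T): T\in\mathcal{T}\}$ is an isomorphism from $\mathcal{N}(G)$ to the face poset of this fan.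
   Context: Let $G$ be a finite simple graph with vertex set $V$; let $\kappa(G)$ be its set of connected components (as vertex subsets) and $n=|V|-|\kappa(G)|$. A tube of $G$ is a nonempty subset of $V$ inducing a connected subgraph; it is proper if it is not a connected component. Two tubes $T,T'$ are compatible if they are nested ($T\subseteq T'$ or $T'\subseteq T$) or disjoint and non-adjacent (i.e. $T\cup T'$ is not a tube). A tubing is a set of pairwise compatible proper tubes; the nested complex $\mathcal{N}(G)$ is the simplicial complex of all tubings. Maximal tubings have exactly $n$ tubes. The compatibility degree of tubes $T,T'$ is $\delta(T\,\|\,T')=-1$ if $T=T'$; $\delta(T\,\|\,T')=$ the number of vertices of $T'\setminus T$ adjacent to some vertex of $T$ if $T\not\subseteq T'$; and $\delta(T\,\|\,T')=0$ otherwise (i.e. $T\subsetneq T'$). For a maximal tubing $\mathcal{T}^\circ=\{T^\circ_1,\dots,T^\circ_n\}$ and a tube $T$, the compatibility vector is $\mathbf{d}(\mathcal{T}^\circ,T)=(\delta(T^\circ_1\,\|\,T),\dots,\delta(T^\circ_n\,\|\,T))\in\mathbb{R}^n$. $\mathbb{R}_{\ge0}X$ denotes the cone generated by a set of vectors $X$. *)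

theory Defs
  imports "HOL-Analysis.Analysis" "HOL-Analysis.Finite_Function_Topology"
begin

section \<open>Finite simple graphs and their nested complexes\<close>

definition finite_simple_graph :: "'a set \<Rightarrow> 'a set set \<Rightarrow> bool" where
  "finite_simple_graph V E \<longleftrightarrow> finite V \<and> (\<forall>e\<in>E. e \<subseteq> V \<and> card e = 2)"

definition adjacent :: "'a set set \<Rightarrow> 'a \<Rightarrow> 'a \<Rightarrow> bool" where
  "adjacent E u v \<longleftrightarrow> {u, v} \<in> E"

definition induced_adjacency :: "'a set set \<Rightarrow> 'a set \<Rightarrow> ('a \<times> 'a) set" where
  "induced_adjacency E S = {(u, v). u \<in> S \<and> v \<in> S \<and> adjacent E u v}"

definition induces_connected :: "'a set set \<Rightarrow> 'a set \<Rightarrow> bool" where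
  "induces_connected E S \<longleftrightarrow> (\<forall>u\<in>S. \<forall>v\<in>S. (u, v) \<in> (induced_adjacency E S)\<^sup>*)"

definition components_of_graph :: "'a set \<Rightarrow> 'a set set \<Rightarrow> 'a set set" where
  "components_of_graph V E =
     V // {(u, v). u \<in> V \<and> v \<in> V \<and> (u, v) \<in> (induced_adjacency E V)\<^sup>*}"

definition tube :: "'a set \<Rightarrow> 'a set set \<Rightarrow> 'a set \<Rightarrow> bool" where
  "tube V E T \<longleftrightarrow> T \<noteq> {} \<and> T \<subseteq> V \<and> induces_connected E T"

definition proper_tube :: "'a set \<Rightarrow> 'a set set \<Rightarrow> 'a set \<Rightarrow> bool" where
  "proper_tube V E T \<longleftrightarrow> tube V E T \<and> T \<notin> components_of_graph V E"

definition compatible_tubes :: "'a set set \<Rightarrow> 'a set \<Rightarrow> 'a set \<Rightarrow> bool" where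
  "compatible_tubes E S T \<longleftrightarrow>
     S \<subseteq> T \<or> T \<subseteq> S \<or> (S \<inter> T = {} \<and> \<not> (\<exists>u\<in>S. \<exists>v\<in>T. adjacent E u v))"

definition tubing :: "'a set \<Rightarrow> 'a set set \<Rightarrow> 'a set set \<Rightarrow> bool" where
  "tubing V E \<T> \<longleftrightarrow> (\<forall>T\<in>\<T>. proper_tube V E T) \<and> pairwise (compatible_tubes E) \<T>"

definition maximal_tubing :: "'a set \<Rightarrow> 'a set set \<Rightarrow> 'a set set \<Rightarrow> bool" where
  "maximal_tubing V E \<T> \<longleftrightarrow> tubing V E \<T> \<and> (\<forall>\<T>'. tubing V E \<T>' \<and> \<T> \<subseteq> \<T>' \<longrightarrow> \<T>' = \<T>)"

definition nested_complex :: "'a set \<Rightarrow> 'a set set \<Rightarrow> 'a set set set" where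
  "nested_complex V E = {\<T>. tubing V E \<T>}"

section \<open>Compatibility vectors\<close>

definition compatibility_degree :: "'a set set \<Rightarrow> 'a set \<Rightarrow> 'a set \<Rightarrow> int" where
  "compatibility_degree E S T =
     (if S = T then - 1
      else if \<not> S \<subseteq> T then int (card {v \<in> T - S. \<exists>u\<in>S. adjacent E u v})
      else 0)"

text \<open>
  The space \<open>\<real>\<^sup>n\<close> is the coordinate subspace of the finitely supported sequences that is spanned
  by the unit vectors with index below \<open>n\<close>.  In contrast to a type of vectors indexed by a finite
  type, this includes \<open>n = 0\<close>, which occurs for graphs without edges.
\<close>

definition coordinate_space :: "nat \<Rightarrow> (nat \<Rightarrow>\<^sub>0 real) set" where
  "coordinate_space n = {x. Poly_Mapping.keys x \<subseteq> {..<n}}"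

text \<open>
  The reference tubing is given as a list without repetitions, which fixes the order of the
  coordinates (counted from 0).
\<close>

definition compatibility_vector :: "'a set set \<Rightarrow> 'a set list \<Rightarrow> 'a set \<Rightarrow> (nat \<Rightarrow>\<^sub>0 real)" where
  "compatibility_vector E Ts T =
     (\<Sum>i<length Ts. Poly_Mapping.single i (real_of_int (compatibility_degree E (Ts ! i) T)))"

section \<open>Fans\<close>

text \<open>
  The cone \<open>\<real>\<^sub>\<ge>\<^sub>0 X\<close> is \<open>convex_cone hull X\<close>; it contains 0 also for empty \<open>X\<close>.  The empty set
  counts as a face in the sense of \<open>(face_of)\<close>, but not as a face of a cone in a fan.
\<close>

definition polyhedral_cone :: "'v::real_vector set \<Rightarrow> bool" where
  "polyhedral_cone C \<longleftrightarrow> (\<exists>X. finite X \<and> C = convex_cone hull X)"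

definition simplicial_cone :: "'v::real_vector set \<Rightarrow> bool" where
  "simplicial_cone C \<longleftrightarrow> (\<exists>X. finite X \<and> independent X \<and> C = convex_cone hull X)"

definition polyhedral_fan :: "'v::real_vector set set \<Rightarrow> bool" where
  "polyhedral_fan \<F> \<longleftrightarrow>
     finite \<F> \<and>
     (\<forall>C\<in>\<F>. polyhedral_cone C) \<and>
     (\<forall>C\<in>\<F>. \<forall>F. F face_of C \<and> F \<noteq> {} \<longrightarrow> F \<in> \<F>) \<and>
     (\<forall>C\<in>\<F>. \<forall>D\<in>\<F>. C \<inter> D face_of C \<and> C \<inter> D face_of D)"

definition complete_simplicial_fan :: "'v::real_vector set \<Rightarrow> 'v set set \<Rightarrow> bool" where
  "complete_simplicial_fan W \<F> \<longleftrightarrow>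
     polyhedral_fan \<F> \<and> (\<forall>C\<in>\<F>. simplicial_cone C) \<and> \<Union>\<F> = W"

definition compatibility_cone ::
  "'a set set \<Rightarrow> 'a set list \<Rightarrow> 'a set set \<Rightarrow> (nat \<Rightarrow>\<^sub>0 real) set" where
  "compatibility_cone E Ts \<T> = convex_cone hull (compatibility_vector E Ts ` \<T>)"

definition compatibility_fan ::
  "'a set \<Rightarrow> 'a set set \<Rightarrow> 'a set list \<Rightarrow> (nat \<Rightarrow>\<^sub>0 real) set set" where
  "compatibility_fan V E Ts = {compatibility_cone E Ts \<T> | \<T>. tubing V E \<T>}"

definition poset_isomorphism ::
  "('p \<Rightarrow> 'q) \<Rightarrow> 'p set \<Rightarrow> ('p \<Rightarrow> 'p \<Rightarrow> bool) \<Rightarrow> 'q set \<Rightarrow> ('q \<Rightarrow> 'q \<Rightarrow> bool) \<Rightarrow> bool" where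
  "poset_isomorphism f P le_P Q le_Q \<longleftrightarrow>
     bij_betw f P Q \<and> (\<forall>x\<in>P. \<forall>y\<in>P. le_P x y \<longleftrightarrow> le_Q (f x) (f y))"

end

theory Submission
  imports Defs
begin

text \<open>
  A tubing \<open>\<T>\<close> with positive weights \<open>c\<close> is the same as its height function
  \<open>v \<mapsto> \<Sum>{c T | v \<in> T \<in> \<T>}\<close>, and every nonnegative function on the vertices that vanishes somewhere
  on each component is a height function.  In terms of the height \<open>f\<close>, the \<open>S\<close>-coordinate of
  \<open>\<Sum> c T \<cdot> d(T)\<close> is the piecewise linear expression
  \<open>(\<Sum>v\<in>N. max 0 (f v - m)) - max 0 (m - Max (f ` N))\<close>, where \<open>N\<close> is the neighbourhood of \<open>S\<close> and \<open>m\<close>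
  is the minimum of \<open>f\<close> over \<open>S\<close>; it is strictly decreasing in \<open>m\<close>.  The reference tubing is a
  forest in which each tube has exactly one vertex, its root, outside its child tubes, and the
  neighbours of a tube are roots of its ancestors.  Hence prescribed coordinates can be solved for
  \<open>f\<close> from the components downwards, and every step has exactly one solution.  So each vector has
  exactly one representation as a positive combination over a tubing, which is equivalent to the
  complete simplicial fan property.
\<close>

section \<open>Convex geometry of cones indexed by a simplicial complex\<close>

section \<open>Fans from unique positive representations\<close>

text \<open>The nonnegative combinations contain the generators, form a convex cone and lie in every
  convex cone containing the generators; the induction serves the last point only. Coefficients are
  indexed by \<open>A\<close> rather than by the vectors themselves, because injectivity of
  \<open>d\<close> on a simplex is only derived later, in \<open>inj_on_rays\<close>.\<close>

lemma convex_cone_hull_image_finite: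
  fixes d :: "'i \<Rightarrow> 'v::real_vector"
  assumes "finite A"
  shows "convex_cone hull (d ` A) = {(\<Sum>i\<in>A. c i *\<^sub>R d i) | c. \<forall>i\<in>A. 0 \<le> c i}"
  using assms
proof (induction A)
  case empty
  then show ?case by auto
next
  case (insert a A)
  let ?C = "\<lambda>A. {(\<Sum>i\<in>A. c i *\<^sub>R d i) | c. \<forall>i\<in>A. 0 \<le> c i}"
  show ?case
  proof (rule hull_unique)
    show "d ` insert a A \<subseteq> ?C (insert a A)"
    proof clarify
      fix i assume i: "i \<in> insert a A"
      have "(\<Sum>j\<in>insert a A. (if i = j then 1 else 0 :: real) *\<^sub>R d j)
          = (\<Sum>j\<in>insert a A. if i = j then d j else 0)"
        by (rule sum.cong) auto
      also have "\<dots> = d i"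
        using i insert.hyps by (subst sum.delta') auto
      finally have "d i = (\<Sum>j\<in>insert a A. (if i = j then 1 else 0 :: real) *\<^sub>R d j)" by simp
      then show "\<exists>c. d i = (\<Sum>j\<in>insert a A. c j *\<^sub>R d j) \<and> (\<forall>j\<in>insert a A. 0 \<le> c j)"
        by (intro exI[of _ "\<lambda>j. if i = j then 1 else 0"]) simp
    qed
    show "convex_cone (?C (insert a A))"
      unfolding convex_cone_iff
    proof (intro conjI ballI allI impI)
      show "0 \<in> ?C (insert a A)"
        by (rule CollectI, rule exI[of _ "\<lambda>_. 0"]) simp
    next
      fix x y assume "x \<in> ?C (insert a A)" "y \<in> ?C (insert a A)"
      then obtain c e where "x = (\<Sum>i\<in>insert a A. c i *\<^sub>R d i)" "y = (\<Sum>i\<in>insert a A. e i *\<^sub>R d i)"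
        "\<forall>i\<in>insert a A. 0 \<le> c i" "\<forall>i\<in>insert a A. 0 \<le> e i" by blast
      then show "x + y \<in> ?C (insert a A)"
        by (intro CollectI exI[of _ "\<lambda>i. c i + e i"]) (simp add: scaleR_left_distrib sum.distrib insert.hyps)
    next
      fix x and k :: real assume "x \<in> ?C (insert a A)" "0 \<le> k"
      then obtain c where "x = (\<Sum>i\<in>insert a A. c i *\<^sub>R d i)" "\<forall>i\<in>insert a A. 0 \<le> c i" by blast
      then show "k *\<^sub>R x \<in> ?C (insert a A)"
        using \<open>0 \<le> k\<close>
        by (intro CollectI exI[of _ "\<lambda>i. k * c i"])
          (simp add: scaleR_right_distrib scaleR_sum_right insert.hyps)
    qed
  next
    fix K assume K: "d ` insert a A \<subseteq> K" "convex_cone K"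
    have "convex_cone hull (d ` A) \<subseteq> K"
      using K by (intro hull_minimal) auto
    then have 1: "?C A \<subseteq> K" using insert.IH by simp
    show "?C (insert a A) \<subseteq> K"
    proof clarify
      fix c :: "'i \<Rightarrow> real" assume c: "\<forall>i\<in>insert a A. 0 \<le> c i"
      have "(\<Sum>i\<in>A. c i *\<^sub>R d i) \<in> K" using 1 c by blast
      moreover have "c a *\<^sub>R d a \<in> K"
        using K c by (simp add: convex_cone_iff)
      ultimately show "(\<Sum>i\<in>insert a A. c i *\<^sub>R d i) \<in> K"
        using K insert.hyps by (simp add: convex_cone_iff)
    qed
  qed
qed

text \<open>Interface between the combinatorial and the convex part: the relatively open cones over
  the simplices partition \<open>W\<close>, and inside each of them the coefficients are unique. No
  linear independence is assumed; it follows.\<close>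

locale unique_positive_representation =
  fixes \<Delta> :: "'i set set" and d :: "'i \<Rightarrow> 'v::real_vector" and W :: "'v set"
  assumes finite_complex: "finite \<Delta>"
    and finite_simplex: "A \<in> \<Delta> \<Longrightarrow> finite A"
    and simplex_subset: "A \<in> \<Delta> \<Longrightarrow> B \<subseteq> A \<Longrightarrow> B \<in> \<Delta>"
    and unique: "A \<in> \<Delta> \<Longrightarrow> B \<in> \<Delta> \<Longrightarrow> (\<And>i. i \<in> A \<Longrightarrow> 0 < c i) \<Longrightarrow> (\<And>i. i \<in> B \<Longrightarrow> 0 < e i) \<Longrightarrow>
      (\<Sum>i\<in>A. c i *\<^sub>R d i) = (\<Sum>i\<in>B. e i *\<^sub>R d i) \<Longrightarrow> A = B \<and> (\<forall>i\<in>A. c i = e i)"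
    and covered: "x \<in> W \<longleftrightarrow> (\<exists>A\<in>\<Delta>. \<exists>c. (\<forall>i\<in>A. 0 < c i) \<and> x = (\<Sum>i\<in>A. c i *\<^sub>R d i))"
begin

definition ray_cone :: "'i set \<Rightarrow> 'v set" where
  "ray_cone A = convex_cone hull (d ` A)"

lemma mem_ray_cone:
  "A \<in> \<Delta> \<Longrightarrow> x \<in> ray_cone A \<longleftrightarrow> (\<exists>c. (\<forall>i\<in>A. 0 \<le> c i) \<and> x = (\<Sum>i\<in>A. c i *\<^sub>R d i))"
  unfolding ray_cone_def by (subst convex_cone_hull_image_finite[OF finite_simplex]) (simp_all only: mem_Collect_eq conj_commute)

text \<open>Dropping the zero coefficients leaves positive combinations over the two supports, which
  are again simplices, so \<open>unique\<close> applies to them.\<close>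

lemma unique_nonneg:
  assumes A: "A \<in> \<Delta>" and B: "B \<in> \<Delta>" and c: "\<And>i. i \<in> A \<Longrightarrow> 0 \<le> c i" and e: "\<And>i. i \<in> B \<Longrightarrow> 0 \<le> e i"
    and eq: "(\<Sum>i\<in>A. c i *\<^sub>R d i) = (\<Sum>i\<in>B. e i *\<^sub>R d i)"
  shows "{i\<in>A. 0 < c i} = {i\<in>B. 0 < e i} \<and> (\<forall>i\<in>A \<inter> B. c i = e i)"
proof -
  let ?A = "{i\<in>A. 0 < c i}" and ?B = "{i\<in>B. 0 < e i}"
  have "(\<Sum>i\<in>A. c i *\<^sub>R d i) = (\<Sum>i\<in>?A. c i *\<^sub>R d i)"
    using finite_simplex[OF A] c by (intro sum.mono_neutral_right) (auto simp: order.order_iff_strict)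
  moreover have "(\<Sum>i\<in>B. e i *\<^sub>R d i) = (\<Sum>i\<in>?B. e i *\<^sub>R d i)"
    using finite_simplex[OF B] e by (intro sum.mono_neutral_right) (auto simp: order.order_iff_strict)
  ultimately have u: "?A = ?B \<and> (\<forall>i\<in>?A. c i = e i)"
    using eq simplex_subset[OF A, of ?A] simplex_subset[OF B, of ?B]
    by (intro unique) auto
  moreover have "c i = e i" if "i \<in> A" "i \<in> B" for i
  proof (cases "i \<in> ?A")
    case False
    then have "i \<notin> ?B" using u by simp
    with False that c[of i] e[of i] show ?thesis by simp
  qed (use u in blast)
  ultimately show ?thesis by blast
qed

lemma inj_on_rays:
  assumes "A \<in> \<Delta>"
  shows "inj_on d A"
proof (rule inj_onI)
  fix i j assume "i \<in> A" "j \<in> A" "d i = d j"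
  then have "{i} = {j} \<and> (\<forall>k\<in>{i}. (1::real) = 1)"
    using assms by (intro unique) (auto intro: simplex_subset)
  then show "i = j" by simp
qed

text \<open>The positive and the negative part of a linear relation are two nonnegative
  representations of one vector over the same simplex. Their coefficients agree, which forces each
  coefficient of the relation to vanish.\<close>

lemma independent_rays:
  assumes A: "A \<in> \<Delta>"
  shows "independent (d ` A)"
proof
  assume "dependent (d ` A)"
  then obtain u where u: "\<exists>v\<in>d ` A. u v \<noteq> 0" "(\<Sum>v\<in>d ` A. u v *\<^sub>R v) = 0"
    using dependent_finite[of "d ` A"] finite_simplex[OF A] by auto
  have "(\<Sum>i\<in>A. u (d i) *\<^sub>R d i) = 0"
    using u(2) sum.reindex[OF inj_on_rays[OF A], of "\<lambda>v. u v *\<^sub>R v"] by simp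
  moreover have "u (d i) *\<^sub>R d i = max 0 (u (d i)) *\<^sub>R d i - max 0 (- u (d i)) *\<^sub>R d i" for i
    by (simp add: max_def)
  ultimately have "(\<Sum>i\<in>A. max 0 (u (d i)) *\<^sub>R d i) = (\<Sum>i\<in>A. max 0 (- u (d i)) *\<^sub>R d i)"
    by (simp add: sum_subtractf)
  from unique_nonneg[OF A A _ _ this] have "\<forall>i\<in>A. max 0 (u (d i)) = max 0 (- u (d i))"
    by simp
  then have "\<forall>i\<in>A. u (d i) = 0" by (auto simp: max_def split: if_splits)
  with u(1) show False by blast
qed

lemma ray_cone_mono: "B \<subseteq> A \<Longrightarrow> ray_cone B \<subseteq> ray_cone A"
  unfolding ray_cone_def by (intro hull_mono) blast

text \<open>The sum of all rays of \<open>A\<close> has support \<open>A\<close>, so it can lie in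
  the cone over \<open>B\<close> only if \<open>B\<close> contains \<open>A\<close>.\<close>

lemma ray_cone_subset_iff:
  assumes A: "A \<in> \<Delta>" and B: "B \<in> \<Delta>"
  shows "ray_cone A \<subseteq> ray_cone B \<longleftrightarrow> A \<subseteq> B"
proof
  assume "ray_cone A \<subseteq> ray_cone B"
  moreover have "(\<Sum>i\<in>A. 1 *\<^sub>R d i) \<in> ray_cone A"
    unfolding mem_ray_cone[OF A] by (rule exI[of _ "\<lambda>_. 1"]) simp
  ultimately have "(\<Sum>i\<in>A. 1 *\<^sub>R d i) \<in> ray_cone B" by (rule subsetD)
  then obtain e where e: "\<forall>i\<in>B. 0 \<le> e i" and eq: "(\<Sum>i\<in>A. 1 *\<^sub>R d i) = (\<Sum>i\<in>B. e i *\<^sub>R d i)"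
    unfolding mem_ray_cone[OF B] by (elim exE conjE)
  have "{i\<in>A. (0::real) < 1} = {i\<in>B. 0 < e i}"
    by (rule unique_nonneg[OF A B _ _ eq, THEN conjunct1]) (use e in simp_all)
  then show "A \<subseteq> B" by auto
qed (rule ray_cone_mono)

text \<open>A common point has the same support in both representations, hence a support inside
  \<open>A \<inter> B\<close>.\<close>

lemma ray_cone_Int:
  assumes A: "A \<in> \<Delta>" and B: "B \<in> \<Delta>"
  shows "ray_cone A \<inter> ray_cone B = ray_cone (A \<inter> B)"
proof
  show "ray_cone A \<inter> ray_cone B \<subseteq> ray_cone (A \<inter> B)"
  proof
    fix x assume "x \<in> ray_cone A \<inter> ray_cone B"
    then obtain c e where c: "\<forall>i\<in>A. 0 \<le> c i" "x = (\<Sum>i\<in>A. c i *\<^sub>R d i)"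
      and e: "\<forall>i\<in>B. 0 \<le> e i" "x = (\<Sum>i\<in>B. e i *\<^sub>R d i)"
      unfolding Int_iff mem_ray_cone[OF A] mem_ray_cone[OF B] by (elim exE conjE)
    have "{i\<in>A. 0 < c i} = {i\<in>B. 0 < e i}"
      by (rule unique_nonneg[OF A B _ _ trans[OF c(2)[symmetric] e(2)], THEN conjunct1])
        (use c(1) e(1) in simp_all)
    then have "c i = 0" if "i \<in> A - A \<inter> B" for i
      using that c(1) by (force simp: order.order_iff_strict)
    then have "x = (\<Sum>i\<in>A \<inter> B. c i *\<^sub>R d i)"
      unfolding c(2) using finite_simplex[OF A] by (intro sum.mono_neutral_right) auto
    moreover have "A \<inter> B \<in> \<Delta>" by (rule simplex_subset[OF A]) simp
    ultimately show "x \<in> ray_cone (A \<inter> B)"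
      using c(1) unfolding mem_ray_cone[OF \<open>A \<inter> B \<in> \<Delta>\<close>] by (intro exI[of _ c]) simp
  qed
qed (use ray_cone_mono in auto)

text \<open>The coefficients of a point inside a segment are a strict mixture of those of the
  endpoints. A ray absent from the point is therefore absent from both endpoints, since nothing can
  cancel.\<close>

lemma ray_cone_face:
  assumes A: "A \<in> \<Delta>" and BA: "B \<subseteq> A"
  shows "ray_cone B face_of ray_cone A"
  unfolding face_of_def
proof (intro conjI ballI impI)
  have B: "B \<in> \<Delta>" using simplex_subset[OF A BA] .
  show "ray_cone B \<subseteq> ray_cone A" using ray_cone_mono[OF BA] .
  show "convex (ray_cone B)" unfolding ray_cone_def by (rule convex_convex_cone_hull)
  fix a b x assume abx: "a \<in> ray_cone A" "b \<in> ray_cone A" "x \<in> ray_cone B" "x \<in> open_segment a b"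
  obtain p where p: "\<forall>i\<in>A. 0 \<le> p i" "a = (\<Sum>i\<in>A. p i *\<^sub>R d i)"
    using abx(1) unfolding mem_ray_cone[OF A] by (elim exE conjE)
  obtain q where q: "\<forall>i\<in>A. 0 \<le> q i" "b = (\<Sum>i\<in>A. q i *\<^sub>R d i)"
    using abx(2) unfolding mem_ray_cone[OF A] by (elim exE conjE)
  obtain r where r: "\<forall>i\<in>B. 0 \<le> r i" "x = (\<Sum>i\<in>B. r i *\<^sub>R d i)"
    using abx(3) unfolding mem_ray_cone[OF B] by (elim exE conjE)
  obtain t where t: "0 < t" "t < 1" "x = (1 - t) *\<^sub>R a + t *\<^sub>R b"
    using abx unfolding in_segment by auto
  let ?s = "\<lambda>i. (1 - t) * p i + t * q i"
  have s: "x = (\<Sum>i\<in>A. ?s i *\<^sub>R d i)"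
    unfolding t(3) p(2) q(2) by (simp add: scaleR_left_distrib sum.distrib scaleR_sum_right)
  have eq: "{i\<in>A. 0 < ?s i} = {i\<in>B. 0 < r i}"
    by (rule unique_nonneg[OF A B _ _ trans[OF s[symmetric] r(2)], THEN conjunct1])
      (use p(1) q(1) r(1) t(1,2) in simp_all)
  have z: "p i = 0 \<and> q i = 0" if "i \<in> A - B" for i
  proof -
    have "?s i \<le> 0" "0 \<le> (1 - t) * p i" "0 \<le> t * q i"
      using that eq p(1) q(1) t(1,2) by auto
    then have "(1 - t) * p i = 0" "t * q i = 0" by linarith+
    then show ?thesis using t(1,2) by auto
  qed
  have "a = (\<Sum>i\<in>B. p i *\<^sub>R d i)" "b = (\<Sum>i\<in>B. q i *\<^sub>R d i)"
    unfolding p(2) q(2) using finite_simplex[OF A] BA z by (auto intro!: sum.mono_neutral_right)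
  then show "a \<in> ray_cone B" "b \<in> ray_cone B"
    unfolding mem_ray_cone[OF B] using p(1) q(1) BA by (auto intro: exI[of _ p] exI[of _ q])
qed

text \<open>\<open>B\<close> collects the rays lying in the face. Every ray that occurs with
  positive coefficient in a point of the face is among them, by a midpoint argument.\<close>

lemma face_of_ray_cone:
  assumes A: "A \<in> \<Delta>" and F: "F face_of ray_cone A" "F \<noteq> {}"
  obtains B where "B \<subseteq> A" "F = ray_cone B"
proof
  define B where "B = {i\<in>A. d i \<in> F}"
  show "B \<subseteq> A" unfolding B_def by blast
  then have B: "B \<in> \<Delta>" by (rule simplex_subset[OF A])
  have conic: "conic F"
    using F face_of_conic conic_convex_cone_hull unfolding ray_cone_def by blast
  then have cc: "convex_cone F"
    using F unfolding convex_cone_def by (auto dest: face_of_imp_convex)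
  have "ray_cone B \<subseteq> F"
    unfolding ray_cone_def using cc by (intro hull_minimal) (auto simp: B_def)
  moreover have "F \<subseteq> ray_cone B"
  proof
    fix x assume xF: "x \<in> F"
    then have "x \<in> ray_cone A" using F face_of_imp_subset by blast
    then obtain c where c: "\<forall>i\<in>A. 0 \<le> c i" "x = (\<Sum>i\<in>A. c i *\<^sub>R d i)"
      unfolding mem_ray_cone[OF A] by (elim exE conjE)
    have dF: "d i \<in> F" if i: "i \<in> A" "c i \<noteq> 0" for i
    proof -
      define y where "y = (\<Sum>j\<in>A - {i}. c j *\<^sub>R d j)"
      have xy: "x = c i *\<^sub>R d i + y"
        unfolding c(2) y_def by (rule sum.remove) (use finite_simplex[OF A] i in auto)
      have Ai: "A - {i} \<in> \<Delta>" using simplex_subset[OF A] by blast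
      have "y \<in> ray_cone (A - {i})"
        unfolding mem_ray_cone[OF Ai] y_def using c(1) by (intro exI[of _ c]) simp
      then have "y \<in> ray_cone A"
        using ray_cone_mono[of "A - {i}" A] by blast
      then have y2: "2 *\<^sub>R y \<in> ray_cone A"
        unfolding ray_cone_def by (rule convex_cone_hull_mul) simp
      have d2: "(2 * c i) *\<^sub>R d i \<in> ray_cone A"
        unfolding ray_cone_def using c(1) i by (intro convex_cone_hull_mul hull_inc) auto
      \<comment> \<open>Doubling the summand of \<open>i\<close> and doubling the rest gives two
        points of the cone whose midpoint is \<open>x\<close>; the face property then puts both into
        \<open>F\<close>.\<close>
      have mid: "x = (1 - 1/2) *\<^sub>R ((2 * c i) *\<^sub>R d i) + (1/2) *\<^sub>R (2 *\<^sub>R y)"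
        unfolding xy by simp
      have "(2 * c i) *\<^sub>R d i \<in> F"
      proof (cases "(2 * c i) *\<^sub>R d i = 2 *\<^sub>R y")
        \<comment> \<open>An open segment has distinct endpoints, so this degenerate case is
          separate: both endpoints then coincide with \<open>x\<close>.\<close>
        case True
        then have "2 *\<^sub>R (c i *\<^sub>R d i) = 2 *\<^sub>R y" by simp
        then have "c i *\<^sub>R d i = y" by (simp only: scaleR_cancel_left) simp
        then have "(2 * c i) *\<^sub>R d i = x" unfolding xy using True by (simp add: scaleR_2)
        then show ?thesis using xF by simp
      next
        case False
        then have "x \<in> open_segment ((2 * c i) *\<^sub>R d i) (2 *\<^sub>R y)"
          unfolding in_segment using mid by (intro conjI exI[of _ "1/2"]) auto
        then show ?thesis using F(1) xF y2 d2 unfolding face_of_def by blast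
      qed
      then have "(1 / (2 * c i)) *\<^sub>R ((2 * c i) *\<^sub>R d i) \<in> F"
        by (rule conicD[OF conic]) (use c(1) i in simp)
      moreover have "(1 / (2 * c i)) *\<^sub>R ((2 * c i) *\<^sub>R d i) = d i"
        using i by (simp only: scaleR_scaleR) simp
      ultimately show ?thesis by (simp only:)
    qed
    then have "x = (\<Sum>i\<in>B. c i *\<^sub>R d i)"
      unfolding c(2) B_def using finite_simplex[OF A] by (intro sum.mono_neutral_right) auto
    then show "x \<in> ray_cone B"
      unfolding mem_ray_cone[OF B] using c(1) by (intro exI[of _ c]) (simp add: B_def)
  qed
  ultimately show "F = ray_cone B" by blast
qed

lemma complete_simplicial_fan_ray_cones: "complete_simplicial_fan W (ray_cone ` \<Delta>)"
  unfolding complete_simplicial_fan_def polyhedral_fan_def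
proof (intro conjI ballI allI impI)
  show "finite (ray_cone ` \<Delta>)" using finite_complex by simp
  fix C assume "C \<in> ray_cone ` \<Delta>"
  then obtain A where A: "A \<in> \<Delta>" and C: "C = convex_cone hull (d ` A)"
    unfolding ray_cone_def by blast
  have fin: "finite (d ` A)" using finite_simplex[OF A] by simp
  show "polyhedral_cone C"
    unfolding polyhedral_cone_def using fin C by (intro exI conjI)
  show "simplicial_cone C"
    unfolding simplicial_cone_def using fin independent_rays[OF A] C by (intro exI conjI)
next
  show "F \<in> ray_cone ` \<Delta>" if "C \<in> ray_cone ` \<Delta>" "F face_of C \<and> F \<noteq> {}" for C F
  proof -
    from that obtain A where A: "A \<in> \<Delta>" "F face_of ray_cone A" "F \<noteq> {}" by blast
    from face_of_ray_cone[OF this] obtain B where "B \<subseteq> A" "F = ray_cone B" .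
    with simplex_subset[OF A(1)] show ?thesis by blast
  qed
  show "C \<inter> D face_of C" "C \<inter> D face_of D" if CD: "C \<in> ray_cone ` \<Delta>" "D \<in> ray_cone ` \<Delta>" for C D
  proof -
    from CD obtain A B where "A \<in> \<Delta>" "B \<in> \<Delta>" "C = ray_cone A" "D = ray_cone B" by blast
    then show "C \<inter> D face_of C" "C \<inter> D face_of D"
      by (simp_all add: ray_cone_Int ray_cone_face)
  qed
  show "\<Union> (ray_cone ` \<Delta>) = W"
  proof (intro equalityI subsetI)
    fix x assume "x \<in> \<Union> (ray_cone ` \<Delta>)"
    then obtain A c where A: "A \<in> \<Delta>" "\<forall>i\<in>A. 0 \<le> c i" "x = (\<Sum>i\<in>A. c i *\<^sub>R d i)"
      by (auto simp only: mem_ray_cone Union_iff image_iff bex_simps)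
    let ?A = "{i\<in>A. 0 < c i}"
    have "x = (\<Sum>i\<in>?A. c i *\<^sub>R d i)"
      unfolding A(3) using finite_simplex[OF A(1)] A(2)
      by (intro sum.mono_neutral_right) (auto simp: order.order_iff_strict)
    moreover have "?A \<in> \<Delta>" by (rule simplex_subset[OF A(1)]) blast
    ultimately show "x \<in> W" unfolding covered by (intro bexI[of _ ?A] exI[of _ c]) auto
  next
    fix x assume "x \<in> W"
    then obtain A c where A: "A \<in> \<Delta>" "\<forall>i\<in>A. 0 < c i" "x = (\<Sum>i\<in>A. c i *\<^sub>R d i)"
      unfolding covered by blast
    then have "x \<in> ray_cone A"
      unfolding mem_ray_cone[OF A(1)] by (intro exI[of _ c]) (simp add: less_imp_le)
    with A(1) show "x \<in> \<Union> (ray_cone ` \<Delta>)" by blast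
  qed
qed

lemma poset_isomorphism_ray_cone:
  "poset_isomorphism ray_cone \<Delta> (\<subseteq>) (ray_cone ` \<Delta>) (face_of)"
  unfolding poset_isomorphism_def bij_betw_def
proof (intro conjI ballI)
  show "inj_on ray_cone \<Delta>"
    by (rule inj_onI) (metis ray_cone_subset_iff subset_antisym subset_refl)
  show "A \<subseteq> B \<longleftrightarrow> ray_cone A face_of ray_cone B" if "A \<in> \<Delta>" "B \<in> \<Delta>" for A B
    using ray_cone_subset_iff[OF that] ray_cone_face[OF that(2), of A] face_of_imp_subset[of "ray_cone A" "ray_cone B"]
    by blast
qed simp

end

section \<open>Weighted tubings\<close>

locale simple_graph =
  fixes V :: "'a set" and E :: "'a set set"
  assumes graph: "finite_simple_graph V E"
begin

abbreviation "adj \<equiv> adjacent E"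
abbreviation "conn \<equiv> induces_connected E"
abbreviation "comps \<equiv> components_of_graph V E"

definition nb :: "'a set \<Rightarrow> 'a set" where
  "nb S = {v \<in> V - S. \<exists>u\<in>S. adj u v}"

lemma finite_V: "finite V"
  using graph unfolding finite_simple_graph_def by blast

lemma finite_subset_V: "S \<subseteq> V \<Longrightarrow> finite S"
  using finite_V finite_subset by blast

lemma adj_sym: "adj u v \<Longrightarrow> adj v u"
  unfolding adjacent_def by (simp add: insert_commute)

lemma adj_in_V: "adj u v \<Longrightarrow> u \<in> V \<and> v \<in> V"
  using graph unfolding adjacent_def finite_simple_graph_def by (metis insert_subset)

lemma nb_subset: "nb S \<subseteq> V"
  unfolding nb_def by blast

lemma finite_nb: "finite (nb S)"
  by (rule finite_subset_V[OF nb_subset])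

lemma nb_disjoint: "v \<in> nb S \<Longrightarrow> v \<notin> S"
  unfolding nb_def by blast

lemma nbI: "u \<in> S \<Longrightarrow> adj u v \<Longrightarrow> v \<notin> S \<Longrightarrow> v \<in> nb S"
  unfolding nb_def using adj_in_V by blast

text \<open>Connectivity without paths: a path from inside \<open>A\<close> to outside must cross
  the cut somewhere. Conversely, taking for \<open>A\<close> the vertices reachable from
  \<open>u\<close> leaves no crossing edge, so all of \<open>S\<close> is reachable.\<close>

lemma conn_iff_cut:
  "conn S \<longleftrightarrow> (\<forall>A. S \<inter> A \<noteq> {} \<and> \<not> S \<subseteq> A \<longrightarrow> (\<exists>u\<in>S \<inter> A. \<exists>w\<in>S - A. adj u w))"
proof (intro iffI allI impI)
  fix A assume c: "conn S" and A: "S \<inter> A \<noteq> {} \<and> \<not> S \<subseteq> A"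
  then obtain u w where u: "u \<in> S" "u \<in> A" and w: "w \<in> S" "w \<notin> A" by blast
  with c have "(u, w) \<in> (induced_adjacency E S)\<^sup>*"
    unfolding induces_connected_def by blast
  then have "w \<in> A \<or> (\<exists>u\<in>S \<inter> A. \<exists>w\<in>S - A. adj u w)"
  proof induction
    case base
    show ?case using u by blast
  next
    case (step y z)
    then have "y \<in> S" "z \<in> S" "adj y z" unfolding induced_adjacency_def by auto
    with step.IH show ?case by blast
  qed
  with w(2) show "\<exists>u\<in>S \<inter> A. \<exists>w\<in>S - A. adj u w" by satx
next
  assume c: "\<forall>A. S \<inter> A \<noteq> {} \<and> \<not> S \<subseteq> A \<longrightarrow> (\<exists>u\<in>S \<inter> A. \<exists>w\<in>S - A. adj u w)"
  show "conn S" unfolding induces_connected_def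
  proof (intro ballI)
    fix u v assume u: "u \<in> S" and v: "v \<in> S"
    let ?A = "{w. (u, w) \<in> (induced_adjacency E S)\<^sup>*}"
    have "S \<subseteq> ?A"
    proof (rule ccontr)
      assume "\<not> S \<subseteq> ?A"
      moreover have "u \<in> S \<inter> ?A" using u by simp
      ultimately have "\<exists>x\<in>S \<inter> ?A. \<exists>w\<in>S - ?A. adj x w"
        by (intro c[rule_format]) blast
      then obtain x w where "x \<in> S" "(u, x) \<in> (induced_adjacency E S)\<^sup>*"
        "w \<in> S" "(u, w) \<notin> (induced_adjacency E S)\<^sup>*" "adj x w" by blast
      moreover from this have "(x, w) \<in> induced_adjacency E S"
        unfolding induced_adjacency_def by blast
      ultimately show False by (meson rtrancl.rtrancl_into_rtrancl)
    qed
    with v show "(u, v) \<in> (induced_adjacency E S)\<^sup>*" by blast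
  qed
qed

lemma conn_cut:
  assumes "conn S" "S \<inter> A \<noteq> {}" "\<not> S \<subseteq> A"
  obtains u w where "u \<in> S" "u \<in> A" "w \<in> S" "w \<notin> A" "adj u w"
  using assms unfolding conn_iff_cut by (metis DiffE IntE)

lemma conn_subset:
  assumes "conn S" "S \<subseteq> U" "S \<inter> T \<noteq> {}" "\<forall>u\<in>T. \<forall>w\<in>U - T. \<not> adj u w"
  shows "S \<subseteq> T"
  using conn_cut[OF assms(1,3)] assms(2,4) by blast

lemma conn_insert:
  assumes S: "conn S" and u: "u \<in> S" "adj u v"
  shows "conn (insert v S)"
  unfolding conn_iff_cut
proof (intro allI impI)
  fix A assume A: "insert v S \<inter> A \<noteq> {} \<and> \<not> insert v S \<subseteq> A"
  consider "S \<inter> A \<noteq> {}" "\<not> S \<subseteq> A" | "S \<subseteq> A" "v \<notin> A" | "S \<inter> A = {}" "v \<in> A"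
    using A by blast
  then show "\<exists>u\<in>insert v S \<inter> A. \<exists>w\<in>insert v S - A. adj u w"
  proof cases
    case 1
    then show ?thesis using conn_cut[OF S] by (metis DiffI IntI insertCI)
  next
    case 2
    with u show ?thesis by blast
  next
    case 3
    with u adj_sym show ?thesis by blast
  qed
qed

text \<open>An inclusion-maximal connected set around \<open>v\<close> works, because an edge
  leaving it within \<open>U\<close> would allow it to grow by \<open>conn_insert\<close>.\<close>

lemma conn_component:
  assumes "finite U" "v \<in> U"
  obtains T where "T \<subseteq> U" "v \<in> T" "conn T" "\<forall>u\<in>T. \<forall>w\<in>U - T. \<not> adj u w"
proof -
  let ?F = "{T. T \<subseteq> U \<and> v \<in> T \<and> conn T}"
  have "{v} \<in> ?F" using assms unfolding induces_connected_def by simp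
  moreover have "finite ?F" using assms by simp
  ultimately obtain T where T: "T \<in> ?F" "\<forall>T'\<in>?F. T \<subseteq> T' \<longrightarrow> T = T'"
    using finite_has_maximal[of ?F] by auto
  have "\<not> adj u w" if "u \<in> T" "w \<in> U - T" for u w
  proof
    assume "adj u w"
    then have "insert w T \<in> ?F" using conn_insert[of T u w] that T(1) by simp
    then have "T = insert w T" using T(2) subset_insertI by metis
    with that show False by blast
  qed
  with T(1) show ?thesis by (intro that[of T]) auto
qed

text \<open>Trades equivalence classes of reachability for a local criterion. The auxiliary fact
  \<open>eq\<close> shows that a connected set without neighbours is the class of each of its
  vertices.\<close>

lemma mem_comps_iff: "K \<in> comps \<longleftrightarrow> K \<noteq> {} \<and> K \<subseteq> V \<and> conn K \<and> nb K = {}"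
proof -
  let ?R = "{(u, v). u \<in> V \<and> v \<in> V \<and> (u, v) \<in> (induced_adjacency E V)\<^sup>*}"
  have eq: "?R `` {v} = T" if T: "T \<subseteq> V" "v \<in> T" "conn T" "nb T = {}" for v T
  proof (intro equalityI subsetI)
    fix w assume "w \<in> T"
    then have "(v, w) \<in> (induced_adjacency E T)\<^sup>*"
      using T unfolding induces_connected_def by blast
    moreover have "induced_adjacency E T \<subseteq> induced_adjacency E V"
      using T unfolding induced_adjacency_def by blast
    ultimately have "(v, w) \<in> (induced_adjacency E V)\<^sup>*" by (meson rtrancl_mono subsetD)
    with T \<open>w \<in> T\<close> show "w \<in> ?R `` {v}" by auto
  next
    fix w assume "w \<in> ?R `` {v}"
    then have "(v, w) \<in> (induced_adjacency E V)\<^sup>*" by blast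
    then show "w \<in> T"
    proof induction
      case base
      show ?case by (rule T(2))
    next
      case (step y z)
      then have "adj y z" unfolding induced_adjacency_def by simp
      with step.IH T(4) nbI[of y T z] show ?case by blast
    qed
  qed
  show ?thesis
  proof
    assume "K \<in> comps"
    then obtain v where v: "v \<in> V" "K = ?R `` {v}"
      unfolding components_of_graph_def by (elim quotientE)
    obtain T where T: "T \<subseteq> V" "v \<in> T" "conn T" "\<forall>u\<in>T. \<forall>w\<in>V - T. \<not> adj u w"
      using conn_component[OF finite_V v(1)] .
    then have "nb T = {}" unfolding nb_def by blast
    with T eq[of T v] v(2) show "K \<noteq> {} \<and> K \<subseteq> V \<and> conn K \<and> nb K = {}" by auto
  next
    assume K: "K \<noteq> {} \<and> K \<subseteq> V \<and> conn K \<and> nb K = {}"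
    then obtain v where v: "v \<in> K" by blast
    with K have "K = ?R `` {v}" using eq[of K v] by blast
    moreover have "?R `` {v} \<in> V // ?R" using v K by (intro quotientI) blast
    ultimately show "K \<in> comps" unfolding components_of_graph_def by simp
  qed
qed

lemma component_containing:
  assumes "v \<in> V"
  obtains K where "K \<in> comps" "v \<in> K"
proof -
  obtain T where T: "T \<subseteq> V" "v \<in> T" "conn T" "\<forall>u\<in>T. \<forall>w\<in>V - T. \<not> adj u w"
    using conn_component[OF finite_V assms] .
  then have "nb T = {}" unfolding nb_def by blast
  with T show ?thesis by (intro that[of T]) (auto simp: mem_comps_iff)
qed

lemma subset_component:
  assumes "K \<in> comps" "conn S" "S \<inter> K \<noteq> {}" "S \<subseteq> V"
  shows "S \<subseteq> K"
  using conn_subset[OF assms(2,4,3)] assms(1) nbI[of _ K] unfolding mem_comps_iff by blast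

text \<open>Properness becomes a nonempty neighbourhood, which is what makes the later maxima over
  \<open>nb S\<close> meaningful.\<close>

lemma proper_tube_iff:
  "proper_tube V E T \<longleftrightarrow> T \<noteq> {} \<and> T \<subseteq> V \<and> conn T \<and> nb T \<noteq> {}"
  unfolding proper_tube_def tube_def mem_comps_iff by blast

section \<open>Compatibility and elementary closure properties of tubings\<close>

lemma compatible_sym: "compatible_tubes E S T \<Longrightarrow> compatible_tubes E T S"
  unfolding compatible_tubes_def using adj_sym by blast

lemma tubing_finite: "tubing V E \<T> \<Longrightarrow> finite \<T>"
  using finite_V unfolding tubing_def proper_tube_iff
  by (intro finite_subset[of \<T> "Pow V"]) auto

lemma tubing_proper: "tubing V E \<T> \<Longrightarrow> T \<in> \<T> \<Longrightarrow> proper_tube V E T"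
  unfolding tubing_def by blast

lemma tubing_compatible: "tubing V E \<T> \<Longrightarrow> S \<in> \<T> \<Longrightarrow> T \<in> \<T> \<Longrightarrow> compatible_tubes E S T"
  unfolding tubing_def pairwise_def compatible_tubes_def by blast

lemma tubing_subset: "tubing V E \<T> \<Longrightarrow> \<S> \<subseteq> \<T> \<Longrightarrow> tubing V E \<S>"
  unfolding tubing_def by (meson pairwise_subset subsetD)

lemma tubing_insert:
  assumes "tubing V E \<T>" "proper_tube V E T" "\<And>S. S \<in> \<T> \<Longrightarrow> compatible_tubes E T S"
  shows "tubing V E (insert T \<T>)"
  using assms unfolding tubing_def pairwise_insert by (auto intro: compatible_sym)

text \<open>A maximal tube of \<open>\<T>\<close> meeting but not containing \<open>S\<close> has a neighbour in \<open>S\<close>, and no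
  compatible tube can cover that neighbour without containing \<open>S\<close>.\<close>

lemma tubing_free_vertex:
  assumes \<T>: "tubing V E \<T>" and S: "conn S" "S \<noteq> {}"
  shows "\<exists>v\<in>S. \<forall>T\<in>\<T>. v \<in> T \<longrightarrow> S \<subseteq> T"
proof (rule ccontr)
  assume "\<not> (\<exists>v\<in>S. \<forall>T\<in>\<T>. v \<in> T \<longrightarrow> S \<subseteq> T)"
  then have cover: "\<exists>T\<in>\<T>. v \<in> T \<and> \<not> S \<subseteq> T" if "v \<in> S" for v
    using that by simp
  let ?U = "{T\<in>\<T>. S \<inter> T \<noteq> {} \<and> \<not> S \<subseteq> T}"
  have "finite ?U" using tubing_finite[OF \<T>] by simp
  moreover obtain v where v: "v \<in> S" using S(2) by blast
  moreover obtain T where "T \<in> \<T>" "v \<in> T" "\<not> S \<subseteq> T" using cover[OF v] by blast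
  ultimately obtain T where T: "T \<in> ?U" "\<forall>T'\<in>?U. T \<subseteq> T' \<longrightarrow> T = T'"
    using finite_has_maximal[of ?U] by blast
  obtain u w where uw: "u \<in> S" "u \<in> T" "w \<in> S" "w \<notin> T" "adj u w"
    using conn_cut[OF S(1), of T] T(1) by blast
  obtain T' where T': "T' \<in> \<T>" "w \<in> T'" "\<not> S \<subseteq> T'" using cover uw(3) by blast
  then have "T' \<in> ?U" using uw(3) by blast
  moreover have "compatible_tubes E T T'" using tubing_compatible[OF \<T>] T(1) T'(1) by simp
  moreover have "T \<noteq> T'" using T'(2) uw(4) by blast
  then have "\<not> T \<subseteq> T'" using bspec[OF T(2) \<open>T' \<in> ?U\<close>] by simp
  ultimately show False
    using uw(2,4,5) T'(2) unfolding compatible_tubes_def by blast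
qed

section \<open>Height functions of weighted tubings and their inversion\<close>

text \<open>The linear counterpart of a minimum: for a tubing with nonnegative weights and a
  nonempty connected \<open>S\<close> it equals the minimum of the height over \<open>S\<close>, by
  \<open>Min_height\<close>.\<close>

definition weight :: "'a set set \<Rightarrow> ('a set \<Rightarrow> real) \<Rightarrow> 'a set \<Rightarrow> real" where
  "weight \<T> c S = (\<Sum>T\<in>\<T>. c T * of_bool (S \<subseteq> T))"

definition height :: "'a set set \<Rightarrow> ('a set \<Rightarrow> real) \<Rightarrow> 'a \<Rightarrow> real" where
  "height \<T> c v = weight \<T> c {v}"

lemma weight_antimono:
  assumes "\<And>T. T \<in> \<T> \<Longrightarrow> 0 \<le> c T" "S \<subseteq> S'"
  shows "weight \<T> c S' \<le> weight \<T> c S"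
  unfolding weight_def using assms by (intro sum_mono mult_left_mono) auto

text \<open>By \<open>tubing_free_vertex\<close>, some vertex of \<open>S\<close> lies only in tubes
  that contain all of \<open>S\<close>; there the lower bound is attained.\<close>

lemma Min_height:
  assumes \<T>: "tubing V E \<T>" and c: "\<And>T. T \<in> \<T> \<Longrightarrow> 0 \<le> c T"
    and S: "conn S" "S \<noteq> {}" "S \<subseteq> V"
  shows "Min (height \<T> c ` S) = weight \<T> c S"
proof (rule Min_eqI)
  show "finite (height \<T> c ` S)" using finite_subset_V[OF S(3)] by simp
  show "weight \<T> c S \<le> y" if "y \<in> height \<T> c ` S" for y
    using that weight_antimono[OF c] unfolding height_def by auto
  obtain v where v: "v \<in> S" "\<And>T. T \<in> \<T> \<Longrightarrow> v \<in> T \<Longrightarrow> S \<subseteq> T"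
    using tubing_free_vertex[OF \<T> S(1,2)] by blast
  have "height \<T> c v = weight \<T> c S"
    unfolding height_def weight_def using v by (intro sum.cong refl) auto
  with v(1) show "weight \<T> c S \<in> height \<T> c ` S" by (metis imageI)
qed

text \<open>A proper tube containing a whole component would be equal to it, so no tube contributes
  to the weight of \<open>K\<close>.\<close>

lemma height_zero_on_component:
  assumes \<T>: "tubing V E \<T>" and c: "\<And>T. T \<in> \<T> \<Longrightarrow> 0 \<le> c T" and K: "K \<in> comps"
  shows "Min (height \<T> c ` K) = 0"
proof -
  have K': "conn K" "K \<noteq> {}" "K \<subseteq> V" "nb K = {}" using K unfolding mem_comps_iff by auto
  have "\<not> K \<subseteq> T" if T: "T \<in> \<T>" for T
  proof
    assume "K \<subseteq> T"
    moreover have T': "T \<noteq> {} \<and> T \<subseteq> V \<and> conn T \<and> nb T \<noteq> {}"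
      using tubing_proper[OF \<T> T] unfolding proper_tube_iff .
    ultimately have "T = K" using subset_component[OF K, of T] K'(2) by blast
    with T' K' show False by blast
  qed
  then have "weight \<T> c K = 0" unfolding weight_def by (intro sum.neutral) simp
  then show ?thesis using Min_height[OF \<T> c K'(1-3)] by simp
qed

text \<open>Recovers the weights from the height. The minimum over \<open>S\<close> is
  \<open>?s\<close>, the weight of the strictly larger tubes, plus the weight of \<open>S\<close>
  itself; the maximum over \<open>nb S\<close> is at least \<open>?s\<close>, with equality when
  \<open>S\<close> belongs to the tubing.\<close>

lemma height_gap:
  assumes \<T>: "tubing V E \<T>" and c: "\<And>T. T \<in> \<T> \<Longrightarrow> 0 \<le> c T" and S: "proper_tube V E S"
  shows "max 0 (Min (height \<T> c ` S) - Max (height \<T> c ` nb S)) = (if S \<in> \<T> then c S else 0)"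
proof -
  have S': "S \<noteq> {}" "S \<subseteq> V" "conn S" "nb S \<noteq> {}" using S unfolding proper_tube_iff by auto
  let ?s = "\<Sum>T\<in>\<T>. c T * of_bool (S \<subset> T)"
  have "\<exists>w\<in>nb S. \<forall>T\<in>\<T>. S \<subset> T \<longrightarrow> w \<in> T"
  proof (cases "\<exists>T\<in>\<T>. S \<subset> T")
    case False
    with S'(4) show ?thesis by blast
  next
    case True
    let ?U = "{T\<in>\<T>. S \<subset> T}"
    have "finite ?U" "?U \<noteq> {}" using tubing_finite[OF \<T>] True by auto
    then obtain T where T: "T \<in> ?U" "\<forall>T'\<in>?U. T' \<subseteq> T \<longrightarrow> T = T'"
      using finite_has_minimal[of ?U] by auto
    have "conn T" using tubing_proper[OF \<T>] T(1) unfolding proper_tube_iff by blast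
    moreover have "T \<inter> S \<noteq> {}" "\<not> T \<subseteq> S" using T(1) S'(1) by auto
    ultimately obtain u w where uw: "u \<in> T" "u \<in> S" "w \<in> T" "w \<notin> S" "adj u w"
      by (rule conn_cut)
    have "w \<in> T'" if T': "T' \<in> \<T>" "S \<subset> T'" for T'
    proof -
      have "compatible_tubes E T T'" using tubing_compatible[OF \<T>] T(1) T'(1) by simp
      with T T' S'(1) have "T \<subseteq> T'" unfolding compatible_tubes_def by blast
      with uw show ?thesis by blast
    qed
    moreover have "w \<in> nb S" using uw by (intro nbI)
    ultimately show ?thesis by blast
  qed
  then obtain w where w: "w \<in> nb S" "\<And>T. T \<in> \<T> \<Longrightarrow> S \<subset> T \<Longrightarrow> w \<in> T" by blast
  have w_ge: "?s \<le> height \<T> c w"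
    unfolding height_def weight_def using c w(2) by (intro sum_mono mult_left_mono) auto
  have Max_ge: "height \<T> c w \<le> Max (height \<T> c ` nb S)"
    using finite_nb w(1) by (intro Max_ge) auto
  have m: "Min (height \<T> c ` S) = ?s + (if S \<in> \<T> then c S else 0)"
  proof -
    have "c T * of_bool (S \<subseteq> T) = c T * of_bool (S \<subset> T) + (if T = S then c T else 0)" for T
      by auto
    then have "weight \<T> c S = ?s + (\<Sum>T\<in>\<T>. if T = S then c T else 0)"
      unfolding weight_def by (simp only: sum.distrib)
    then show ?thesis
      using Min_height[OF \<T> c S'(3,1,2)] tubing_finite[OF \<T>] by simp
  qed
  show ?thesis
  proof (cases "S \<in> \<T>")
    case False
    then show ?thesis using m w_ge Max_ge by simp
  next
    case True
    \<comment> \<open>A tube through a neighbour of \<open>S\<close> is neither apart from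
      \<open>S\<close> nor inside it, so compatibility makes it strictly larger.\<close>
    have "height \<T> c v \<le> ?s" if v: "v \<in> nb S" for v
    proof -
      have "S \<subset> T" if T: "T \<in> \<T>" "v \<in> T" for T
      proof -
        have "compatible_tubes E S T" using tubing_compatible[OF \<T> True T(1)] .
        with v T(2) show ?thesis unfolding compatible_tubes_def nb_def by blast
      qed
      then show ?thesis
        unfolding height_def weight_def using c by (intro sum_mono mult_left_mono) auto
    qed
    then have "Max (height \<T> c ` nb S) = ?s"
      using w_ge Max_ge finite_nb S'(4) by (intro antisym Max.boundedI) auto
    then show ?thesis using m c[OF True] True by simp
  qed
qed

text \<open>Peels off one connected component \<open>T\<close> of the support, with the minimum of
  \<open>f\<close> over \<open>T\<close> as its weight. The support loses at least the vertex
  \<open>t\<close> where the minimum is attained, so the induction applies to the rest.\<close>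

lemma tubing_decomposition:
  assumes "\<And>v. v \<in> V \<Longrightarrow> 0 \<le> f v" and "\<And>K. K \<in> comps \<Longrightarrow> \<exists>v\<in>K. f v = 0"
  shows "\<exists>\<T> c. tubing V E \<T> \<and> (\<forall>T\<in>\<T>. 0 < c T) \<and> (\<forall>v\<in>V. f v = height \<T> c v)"
  using assms
proof (induction "card {v\<in>V. f v \<noteq> 0}" arbitrary: f rule: less_induct)
  case less
  let ?U = "{v\<in>V. f v \<noteq> 0}"
  show ?case
  proof (cases "?U = {}")
    case True
    then have "\<forall>v\<in>V. f v = height {} (\<lambda>_. 1) v" unfolding height_def weight_def by simp
    moreover have "tubing V E {}" unfolding tubing_def by simp
    ultimately show ?thesis by (intro exI[of _ "{}"] exI[of _ "\<lambda>_. 1"]) simp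
  next
    case False
    then obtain v0 where v0: "v0 \<in> ?U" by blast
    have finU: "finite ?U" using finite_V by simp
    obtain T where T: "T \<subseteq> ?U" "v0 \<in> T" "conn T" "\<forall>u\<in>T. \<forall>w\<in>?U - T. \<not> adj u w"
      using conn_component[OF finU v0] by blast
    \<comment> \<open>Were \<open>T\<close> a component of the graph, \<open>f\<close> would vanish
      somewhere on it, contrary to the choice of \<open>T\<close> inside the support.\<close>
    have proper: "proper_tube V E T"
      unfolding proper_tube_iff
    proof (intro conjI notI)
      assume "nb T = {}"
      with T have "T \<in> comps" unfolding mem_comps_iff by blast
      from less.prems(2)[OF this] T(1) show False by blast
    qed (use T in auto)
    have finT: "finite T" using T(1) finU by (rule finite_subset)
    define m where "m = Min (f ` T)"
    obtain t where t: "t \<in> T" "f t = m"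
    proof -
      have "m \<in> f ` T" unfolding m_def using finT T(2) by (intro Min_in) auto
      then show ?thesis using that by blast
    qed
    have m_le: "m \<le> f v" if "v \<in> T" for v
      unfolding m_def using finT that by simp
    have m_pos: "0 < m" using t T(1) less.prems(1)[of t] by auto
    define g where "g v = (if v \<in> T then f v - m else f v)" for v
    have g_supp: "{v\<in>V. g v \<noteq> 0} \<subseteq> ?U - {t}"
      using T(1) t unfolding g_def by auto
    then have "card {v\<in>V. g v \<noteq> 0} < card ?U"
      using t T(1) finU by (intro psubset_card_mono) auto
    moreover have "0 \<le> g v" if "v \<in> V" for v
      using that less.prems(1) m_le unfolding g_def by simp
    moreover have "\<exists>v\<in>K. g v = 0" if "K \<in> comps" for K
      using less.prems(2)[OF that] T(1) unfolding g_def by force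
    ultimately obtain \<S> e where S: "tubing V E \<S>" "\<forall>T\<in>\<S>. 0 < e T" "\<forall>v\<in>V. g v = height \<S> e v"
      using less.hyps[of g] by auto
    \<comment> \<open>Every vertex of a tube in the smaller tubing has positive \<open>g\<close>.
      Such a tube therefore avoids \<open>t\<close>, hence differs from \<open>T\<close>, and being
      connected inside the support it lies within \<open>T\<close> or apart from it.\<close>
    have S_supp: "S \<subseteq> ?U - {t}" if S': "S \<in> \<S>" for S
    proof
      fix v assume v: "v \<in> S"
      then have vV: "v \<in> V" using tubing_proper[OF S(1) S'] unfolding proper_tube_iff by blast
      have "e S * of_bool ({v} \<subseteq> S) \<le> height \<S> e v"
        unfolding height_def weight_def
        using S' S(2) tubing_finite[OF S(1)] by (intro member_le_sum) (auto simp: less_imp_le)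
      then have "0 < g v" using v S(2,3) S' vV by fastforce
      with vV g_supp show "v \<in> ?U - {t}" by force
    qed
    have notin: "T \<notin> \<S>" using S_supp t by blast
    have "compatible_tubes E T S" if S': "S \<in> \<S>" for S
    proof (cases "S \<inter> T = {}")
      case True
      then show ?thesis
        using S_supp[OF S'] T(4) unfolding compatible_tubes_def by blast
    next
      case False
      have "conn S" using tubing_proper[OF S(1) S'] unfolding proper_tube_iff by blast
      moreover have "S \<subseteq> ?U" using S_supp[OF S'] by blast
      ultimately have "S \<subseteq> T" using conn_subset[of S ?U T] False T(4) by blast
      then show ?thesis unfolding compatible_tubes_def by blast
    qed
    then have tub: "tubing V E (insert T \<S>)"
      using tubing_insert[OF S(1) proper] by blast
    have "height (insert T \<S>) (e(T := m)) v = m * of_bool (v \<in> T) + height \<S> e v" for v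
      unfolding height_def weight_def using notin tubing_finite[OF S(1)]
      by (auto intro!: sum.cong)
    then have "\<forall>v\<in>V. f v = height (insert T \<S>) (e(T := m)) v"
      using S(3) unfolding g_def by auto
    with tub m_pos S(2) show ?thesis
      by (intro exI[of _ "insert T \<S>"] exI[of _ "e(T := m)"]) auto
  qed
qed

end

section \<open>The piecewise linear coordinates\<close>

text \<open>For finite nonempty \<open>N\<close>, the sum is positive exactly when \<open>m\<close>
  is below the maximum of \<open>a\<close> over \<open>N\<close>, and the subtracted term exactly
  when \<open>m\<close> is above it; the function changes sign at that maximum.\<close>

definition psi :: "'b set \<Rightarrow> ('b \<Rightarrow> real) \<Rightarrow> real \<Rightarrow> real" where
  "psi N a m = (\<Sum>v\<in>N. max 0 (a v - m)) - max 0 (m - Max (a ` N))"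

lemma psi_cong: "(\<And>v. v \<in> N \<Longrightarrow> a v = b v) \<Longrightarrow> psi N a m = psi N b m"
  unfolding psi_def by (simp cong: image_cong)

text \<open>Below the maximum of \<open>a\<close> the summand of a maximizing vertex drops strictly;
  from the maximum on the subtracted term grows strictly.\<close>

lemma psi_strict_antimono:
  assumes N: "finite N" "N \<noteq> {}" and m: "m < m'"
  shows "psi N a m' < psi N a m"
proof (cases "m < Max (a ` N)")
  case True
  have "Max (a ` N) \<in> a ` N" using N by (intro Max_in) auto
  then obtain v where v: "v \<in> N" "Max (a ` N) = a v" by auto
  have "(\<Sum>v\<in>N. max 0 (a v - m')) < (\<Sum>v\<in>N. max 0 (a v - m))"
  proof (rule sum_strict_mono_ex1[OF N(1)])
    show "\<forall>v\<in>N. max 0 (a v - m') \<le> max 0 (a v - m)" using m by auto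
    show "\<exists>v\<in>N. max 0 (a v - m') < max 0 (a v - m)" using v m True by (intro bexI[of _ v]) auto
  qed
  moreover have "max 0 (m - Max (a ` N)) \<le> max 0 (m' - Max (a ` N))" using m by simp
  ultimately show ?thesis unfolding psi_def by linarith
next
  case False
  have "(\<Sum>v\<in>N. max 0 (a v - m')) \<le> (\<Sum>v\<in>N. max 0 (a v - m))"
    using m by (intro sum_mono) auto
  moreover have "max 0 (m - Max (a ` N)) < max 0 (m' - Max (a ` N))" using m False by simp
  ultimately show ?thesis unfolding psi_def by linarith
qed

lemma psi_le_iff:
  "finite N \<Longrightarrow> N \<noteq> {} \<Longrightarrow> psi N a m \<le> psi N a m' \<longleftrightarrow> m' \<le> m"
  using psi_strict_antimono[of N m m' a] psi_strict_antimono[of N m' m a]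
  by (cases m m' rule: linorder_cases) auto

text \<open>A value \<open>y \<le> 0\<close> is reached above the maximum, where only the subtracted
  term remains. For positive \<open>y\<close> the intermediate value theorem is used between the
  maximum, with value 0, and \<open>y\<close> below it, where a maximizing vertex alone contributes
  \<open>y\<close>.\<close>

lemma psi_surj:
  assumes N: "finite N" "N \<noteq> {}"
  obtains m where "psi N a m = y"
proof (cases "y \<le> 0")
  case True
  have "(\<Sum>v\<in>N. max 0 (a v - (Max (a ` N) - y))) = 0"
  proof (rule sum.neutral, rule ballI)
    fix v assume "v \<in> N"
    then have "a v \<le> Max (a ` N)" using N by simp
    then show "max 0 (a v - (Max (a ` N) - y)) = 0" using True by simp
  qed
  then have "psi N a (Max (a ` N) - y) = y" unfolding psi_def using True by simp
  then show ?thesis by (rule that)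
next
  case False
  have "Max (a ` N) \<in> a ` N" using N by (intro Max_in) auto
  then obtain v where v: "v \<in> N" "Max (a ` N) = a v" by auto
  have le: "a w \<le> a v" if "w \<in> N" for w
    using that N v(2) by (metis Max_ge finite_imageI imageI)
  have "(\<Sum>w\<in>N. max 0 (a w - a v)) = 0"
    using le by (intro sum.neutral) simp
  then have 0: "psi N a (a v) = 0" unfolding psi_def v(2) by simp
  have "max 0 (a v - (a v - y)) \<le> (\<Sum>w\<in>N. max 0 (a w - (a v - y)))"
    using v(1) N by (intro member_le_sum) auto
  then have 1: "y \<le> psi N a (a v - y)" unfolding psi_def v(2) using False by simp
  have "continuous_on {a v - y..a v} (psi N a)"
    unfolding psi_def by (intro continuous_intros)
  then have "\<exists>m. a v - y \<le> m \<and> m \<le> a v \<and> psi N a m = y"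
    using 0 1 False by (intro IVT2') auto
  then show ?thesis using that by blast
qed

text \<open>Makes the dependence on a single value explicit: \<open>a r\<close> enters with slope
  one, which turns comparisons of \<open>m\<close> into bounds on \<open>a r\<close>.\<close>

lemma psi_below:
  assumes N: "finite N" "r \<in> N" and m: "m \<le> a r"
  shows "psi N a m = a r - m + (\<Sum>v\<in>N - {r}. max 0 (a v - m))"
proof -
  have "a r \<le> Max (a ` N)" using N by simp
  with m have "max 0 (m - Max (a ` N)) = 0" by simp
  then show ?thesis unfolding psi_def using N m by (simp add: sum.remove[of N r])
qed

text \<open>Given the heights around a tube and their minimum \<open>M\<close> over the tube, the height at the root
  \<open>r\<close> of the tube is forced: it is the least value that keeps the minima \<open>m D\<close> over the child
  tubes at or above \<open>M\<close>.\<close>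

lemma root_value:
  fixes x m :: "'c \<Rightarrow> real"
  assumes fin: "finite \<D>" and N: "\<And>D. D \<in> \<D> \<Longrightarrow> finite (N D)" "\<And>D. D \<in> \<D> \<Longrightarrow> r \<in> N D"
    and x: "\<And>D. D \<in> \<D> \<Longrightarrow> psi (N D) a (m D) = x D"
  shows "M \<le> a r \<and> (\<forall>D\<in>\<D>. M \<le> m D) \<and> (a r = M \<or> (\<exists>D\<in>\<D>. m D = M)) \<longleftrightarrow>
    a r = Max (insert M ((\<lambda>D. M + x D - (\<Sum>v\<in>N D - {r}. max 0 (a v - M))) ` \<D>))"
    (is "_ \<longleftrightarrow> a r = Max (insert M (?t ` \<D>))")
proof (cases "M \<le> a r")
  case False
  have "M \<le> Max (insert M (?t ` \<D>))" using fin by simp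
  with False show ?thesis by auto
next
  case True
  \<comment> \<open>As \<open>psi\<close> is strictly decreasing, comparing \<open>M\<close> with
    \<open>m D\<close> amounts to comparing the value of \<open>psi\<close> at \<open>M\<close> with
    \<open>x D\<close>; by \<open>psi_below\<close> the former is \<open>a r\<close> plus terms free
    of \<open>a r\<close>.\<close>
  have le: "M \<le> m D \<longleftrightarrow> ?t D \<le> a r" and ge: "m D \<le> M \<longleftrightarrow> a r \<le> ?t D" if D: "D \<in> \<D>" for D
  proof -
    have ne: "N D \<noteq> {}" using N(2)[OF D] by blast
    have psi: "psi (N D) a M = a r - M + (\<Sum>v\<in>N D - {r}. max 0 (a v - M))"
      using D by (intro psi_below N True)
    show "M \<le> m D \<longleftrightarrow> ?t D \<le> a r"
      using psi_le_iff[OF N(1)[OF D] ne, of a "m D" M] x[OF D] psi by auto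
    show "m D \<le> M \<longleftrightarrow> a r \<le> ?t D"
      using psi_le_iff[OF N(1)[OF D] ne, of a M "m D"] x[OF D] psi by auto
  qed
  have eq: "m D = M \<longleftrightarrow> a r = ?t D" if "D \<in> \<D>" for D
    using le[OF that] ge[OF that] by (metis order.antisym order.refl)
  have "a r = Max (insert M (?t ` \<D>)) \<longleftrightarrow>
    a r \<in> insert M (?t ` \<D>) \<and> (\<forall>y\<in>insert M (?t ` \<D>). y \<le> a r)"
    using fin by (subst eq_commute, subst Max_eq_iff) auto
  also have "\<dots> \<longleftrightarrow> (\<forall>D\<in>\<D>. ?t D \<le> a r) \<and> (a r = M \<or> (\<exists>D\<in>\<D>. a r = ?t D))"
    using True by auto
  also have "\<dots> \<longleftrightarrow> M \<le> a r \<and> (\<forall>D\<in>\<D>. M \<le> m D) \<and> (a r = M \<or> (\<exists>D\<in>\<D>. m D = M))"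
    using True le eq by (metis (no_types, lifting))
  finally show ?thesis by blast
qed

text \<open>A minimum is an attained lower bound, and both halves split over the root and the child
  tubes. The right-hand side has the shape required by \<open>root_value\<close>.\<close>

lemma Min_insert_Union_iff:
  fixes f :: "'b \<Rightarrow> real"
  assumes S: "S = insert r (\<Union>\<D>)" and fin: "finite S" and ne: "{} \<notin> \<D>"
  shows "Min (f ` S) = M \<longleftrightarrow>
    M \<le> f r \<and> (\<forall>D\<in>\<D>. M \<le> Min (f ` D)) \<and> (f r = M \<or> (\<exists>D\<in>\<D>. Min (f ` D) = M))"
proof -
  have D: "finite D" "D \<noteq> {}" "D \<subseteq> S" if "D \<in> \<D>" for D
    using that S ne fin finite_subset[of D S] by auto
  have ge: "M \<le> Min (f ` D) \<longleftrightarrow> (\<forall>v\<in>D. M \<le> f v)" if "D \<in> \<D>" for D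
    using D[OF that] by simp
  have eq: "Min (f ` D) = M \<longleftrightarrow> M \<in> f ` D" if "D \<in> \<D>" "\<forall>v\<in>D. M \<le> f v" for D
    using D[OF that(1)] that(2) by (subst Min_eq_iff) auto
  have all: "(\<forall>v\<in>S. M \<le> f v) \<longleftrightarrow> M \<le> f r \<and> (\<forall>D\<in>\<D>. \<forall>v\<in>D. M \<le> f v)"
    unfolding S by blast
  have "Min (f ` S) = M \<longleftrightarrow> M \<in> f ` S \<and> (\<forall>v\<in>S. M \<le> f v)"
    using fin S by (subst Min_eq_iff) auto
  also have "M \<in> f ` S \<longleftrightarrow> f r = M \<or> (\<exists>D\<in>\<D>. M \<in> f ` D)"
    unfolding S by blast
  finally show ?thesis
    unfolding all using ge eq by (metis (no_types, lifting))
qed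

section \<open>Compatibility degrees as values of piecewise linear functions\<close>

context simple_graph
begin

text \<open>Defined for every function on vertices, so that prescribed coordinates can be solved for
  before any tubing is known.\<close>

definition coordinate :: "'a set \<Rightarrow> ('a \<Rightarrow> real) \<Rightarrow> real" where
  "coordinate S f = psi (nb S) f (Min (f ` S))"

lemma coordinate_cong: 
  assumes "\<And>v. v \<in> S \<union> nb S \<Longrightarrow> f v = g v"
  shows "coordinate S f = coordinate S g"
proof -
  have "f ` S = g ` S" using assms by (intro image_cong) auto
  moreover have "psi (nb S) f m = psi (nb S) g m" for m using assms by (intro psi_cong) auto
  ultimately show ?thesis unfolding coordinate_def by simp
qed

text \<open>One formula for all three cases of the degree. The summands vanish as soon as
  \<open>T\<close> contains \<open>S\<close>, and the last term supplies the value -1; the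
  indicators are those occurring in \<open>weight\<close>.\<close>

lemma compatibility_degree_eq:
  assumes S: "proper_tube V E S" and T: "T \<subseteq> V"
  shows "real_of_int (compatibility_degree E S T) =
    (\<Sum>v\<in>nb S. of_bool (v \<in> T) - of_bool (insert v S \<subseteq> T)) - of_bool (S = T)"
proof -
  consider "S = T" | "S \<noteq> T" "S \<subseteq> T" | "\<not> S \<subseteq> T" by blast
  then show ?thesis
  proof cases
    case 1
    then have "(\<Sum>v\<in>nb S. of_bool (v \<in> T) - of_bool (insert v S \<subseteq> T)) = (0::real)"
      by (intro sum.neutral) (auto dest: nb_disjoint)
    then show ?thesis using 1 by (simp add: compatibility_degree_def)
  next
    case 2
    then have "(\<Sum>v\<in>nb S. of_bool (v \<in> T) - of_bool (insert v S \<subseteq> T)) = (0::real)"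
      by (intro sum.neutral) simp
    then show ?thesis using 2 by (simp add: compatibility_degree_def)
  next
    case 3
    have "{v \<in> T - S. \<exists>u\<in>S. adj u v} = {v \<in> nb S. v \<in> T}"
      using T unfolding nb_def by blast
    then have "real_of_int (compatibility_degree E S T) = real (card {v \<in> nb S. v \<in> T})"
      using 3 by (auto simp: compatibility_degree_def)
    also have "\<dots> = (\<Sum>v\<in>nb S. of_bool (v \<in> T))"
      using finite_nb by (simp add: sum_of_bool_eq Int_def)
    finally show ?thesis using 3 by (auto intro!: sum.cong)
  qed
qed

text \<open>For \<open>v\<close> in \<open>nb S\<close> the set \<open>insert v S\<close> is
  connected, so by \<open>Min_height\<close> the positive part of \<open>height v - ?m\<close> is a
  difference of two weights and thus linear in \<open>c\<close>. The remaining term of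
  \<open>psi\<close> is evaluated by \<open>height_gap\<close>.\<close>

lemma coordinate_height:
  assumes \<T>: "tubing V E \<T>" and c: "\<And>T. T \<in> \<T> \<Longrightarrow> 0 \<le> c T" and S: "proper_tube V E S"
  shows "coordinate S (height \<T> c) = (\<Sum>T\<in>\<T>. c T * real_of_int (compatibility_degree E S T))"
proof -
  have S': "S \<noteq> {}" "S \<subseteq> V" "conn S" using S unfolding proper_tube_iff by auto
  let ?m = "Min (height \<T> c ` S)"
  have nb: "max 0 (height \<T> c v - ?m) = (\<Sum>T\<in>\<T>. c T * (of_bool (v \<in> T) - of_bool (insert v S \<subseteq> T)))"
    if v: "v \<in> nb S" for v
  proof -
    obtain u where "u \<in> S" "adj u v" using v unfolding nb_def by blast
    then have "conn (insert v S)" by (rule conn_insert[OF S'(3)])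
    then have "weight \<T> c (insert v S) = Min (height \<T> c ` insert v S)"
      using S'(2) v nb_subset[of S] by (intro Min_height[OF \<T> c, symmetric]) auto
    also have "\<dots> = min (height \<T> c v) ?m"
      using S' finite_subset_V by simp
    finally have "max 0 (height \<T> c v - ?m) = height \<T> c v - weight \<T> c (insert v S)" by simp
    then show ?thesis
      unfolding height_def weight_def by (simp add: sum_subtractf right_diff_distrib)
  qed
  have "coordinate S (height \<T> c) = (\<Sum>v\<in>nb S. max 0 (height \<T> c v - ?m)) - (if S \<in> \<T> then c S else 0)"
    unfolding coordinate_def psi_def by (simp only: height_gap[where c = c, OF \<T> c S])
  also have "(\<Sum>v\<in>nb S. max 0 (height \<T> c v - ?m)) =
      (\<Sum>v\<in>nb S. \<Sum>T\<in>\<T>. c T * (of_bool (v \<in> T) - of_bool (insert v S \<subseteq> T)))"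
    using nb by (intro sum.cong refl)
  also have "\<dots> = (\<Sum>T\<in>\<T>. c T * (\<Sum>v\<in>nb S. of_bool (v \<in> T) - of_bool (insert v S \<subseteq> T)))"
    by (subst sum.swap) (simp add: sum_distrib_left)
  also have "(if S \<in> \<T> then c S else 0) = (\<Sum>T\<in>\<T>. if S = T then c T else 0)"
    using tubing_finite[OF \<T>] by simp
  also have "\<dots> = (\<Sum>T\<in>\<T>. c T * of_bool (S = T))"
    by (intro sum.cong) auto
  also have "(\<Sum>T\<in>\<T>. c T * (\<Sum>v\<in>nb S. of_bool (v \<in> T) - of_bool (insert v S \<subseteq> T))) - \<dots> =
      (\<Sum>T\<in>\<T>. c T * ((\<Sum>v\<in>nb S. of_bool (v \<in> T) - of_bool (insert v S \<subseteq> T)) - of_bool (S = T)))"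
    by (simp only: sum_subtractf[symmetric] right_diff_distrib[symmetric])
  also have "\<dots> = (\<Sum>T\<in>\<T>. c T * real_of_int (compatibility_degree E S T))"
  proof (rule sum.cong[OF refl])
    fix T assume "T \<in> \<T>"
    then have "T \<subseteq> V" using tubing_proper[OF \<T>] unfolding proper_tube_iff by blast
    then show "c T * ((\<Sum>v\<in>nb S. of_bool (v \<in> T) - of_bool (insert v S \<subseteq> T)) - of_bool (S = T)) =
        c T * real_of_int (compatibility_degree E S T)"
      by (simp only: compatibility_degree_eq[OF S])
  qed
  finally show ?thesis .
qed

end

section \<open>Solving for a function with prescribed coordinates\<close>

text \<open>Disjoint sets share no nonempty subset, so the counts add up. Serves both for the child
  tubes of a tube and for the components of the graph.\<close>

lemma card_subsets_of_disjoint_family: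
  assumes "finite \<D>" "\<And>D. D \<in> \<D> \<Longrightarrow> finite D" "disjoint \<D>" "{} \<notin> \<B>"
    and "\<And>D. D \<in> \<D> \<Longrightarrow> card {T\<in>\<B>. T \<subseteq> D} = card D"
  shows "card (\<Union>D\<in>\<D>. {T\<in>\<B>. T \<subseteq> D}) = card (\<Union>\<D>)"
proof -
  have "{T\<in>\<B>. T \<subseteq> D} \<inter> {T\<in>\<B>. T \<subseteq> D'} = {}" if "D \<in> \<D>" "D' \<in> \<D>" "D \<noteq> D'" for D D'
  proof -
    have "D \<inter> D' = {}" using assms(3) that by (rule disjointD)
    then have "T = {}" if "T \<subseteq> D" "T \<subseteq> D'" for T using that by blast
    with assms(4) show ?thesis by blast
  qed
  then have "card (\<Union>D\<in>\<D>. {T\<in>\<B>. T \<subseteq> D}) = (\<Sum>D\<in>\<D>. card {T\<in>\<B>. T \<subseteq> D})"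
    using assms(1,2) by (intro card_UN_disjoint) (auto intro: finite_subset[of _ "Pow _"])
  also have "\<dots> = sum card \<D>" using assms(5) by (rule sum.cong[OF refl])
  also have "\<dots> = card (\<Union>\<D>)"
    using assms(2,3) by (intro card_Union_disjoint[symmetric])
      (auto simp: disjoint_def pairwise_def disjnt_def)
  finally show ?thesis .
qed

section \<open>Forest structure of the reference tubing\<close>

locale reference_tubing = simple_graph +
  fixes R :: "'a set set"
  assumes reference: "maximal_tubing V E R"
begin

lemma reference_tubing: "tubing V E R"
  using reference unfolding maximal_tubing_def by simp

lemma reference_maximal:
  assumes "proper_tube V E T" "\<And>S. S \<in> R \<Longrightarrow> compatible_tubes E T S"
  shows "T \<in> R"
proof -
  have "tubing V E (insert T R)" using tubing_insert[OF reference_tubing] assms .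
  then have "insert T R = R" using reference unfolding maximal_tubing_def by blast
  then show ?thesis by blast
qed

lemma block:
  assumes "S \<in> R \<union> comps"
  shows "S \<noteq> {}" "S \<subseteq> V" "conn S" "finite S"
proof -
  have "S \<noteq> {} \<and> S \<subseteq> V \<and> conn S"
    using assms tubing_proper[OF reference_tubing, of S] unfolding Un_iff proper_tube_iff mem_comps_iff by auto
  then show "S \<noteq> {}" "S \<subseteq> V" "conn S" "finite S" using finite_subset_V by auto
qed

text \<open>What gluing requires: changing a function inside one member affects neither another
  member nor the neighbourhood of any member.\<close>

definition separated :: "'a set set \<Rightarrow> bool" where
  "separated \<D> \<longleftrightarrow> disjoint \<D> \<and> (\<forall>D\<in>\<D>. \<forall>D'\<in>\<D>. nb D \<inter> D' = {})"

text \<open>\<open>tubing_free_vertex\<close> for the reference tubes strictly inside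
  \<open>S\<close> gives a vertex \<open>r\<close> outside all of them. The connected components of
  \<open>S - {r}\<close> are compatible with every reference tube, so maximality puts them into the
  reference tubing.\<close>

lemma block_root:
  assumes S: "S \<in> R \<union> comps"
  obtains r \<D> where "\<D> \<subseteq> R" "S = insert r (\<Union>\<D>)" "r \<notin> \<Union>\<D>" "separated \<D>"
    "\<forall>D\<in>\<D>. r \<in> nb D \<and> nb D \<subseteq> insert r (nb S)" "\<forall>T\<in>R. T \<subset> S \<longrightarrow> (\<exists>D\<in>\<D>. T \<subseteq> D)"
proof -
  note bS = block[OF S]
  have "tubing V E {T\<in>R. T \<subset> S}" by (rule tubing_subset[OF reference_tubing]) blast
  from tubing_free_vertex[OF this bS(3,1)]
  obtain r where r: "r \<in> S" "\<forall>T\<in>{T\<in>R. T \<subset> S}. r \<in> T \<longrightarrow> S \<subseteq> T" by blast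
  then have r_notin: "r \<notin> T" if "T \<in> R" "T \<subset> S" for T using that by blast
  let ?U = "S - {r}"
  have finU: "finite ?U" using bS(4) by simp
  \<comment> \<open>Reference tubes are connected, so these are components of the subgraph on
    \<open>S - {r}\<close>; \<open>cover\<close> shows that none is missing.\<close>
  define \<D> where "\<D> = {D\<in>R. D \<subseteq> ?U \<and> (\<forall>u\<in>D. \<forall>w\<in>?U - D. \<not> adj u w)}"
  have D: "D \<noteq> {}" "conn D" "D \<in> R" "D \<subseteq> ?U" "\<forall>u\<in>D. \<forall>w\<in>?U - D. \<not> adj u w" if "D \<in> \<D>" for D
    using that block[of D] unfolding \<D>_def by auto
  have cover: "\<exists>D\<in>\<D>. v \<in> D" if v: "v \<in> ?U" for v
  proof -
    obtain D where D: "D \<subseteq> ?U" "v \<in> D" "conn D" "\<forall>u\<in>D. \<forall>w\<in>?U - D. \<not> adj u w"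
      using conn_component[OF finU v] .
    have "S \<inter> D \<noteq> {}" "\<not> S \<subseteq> D" using D(1,2) r(1) by blast+
    with bS(3) obtain u w where uw: "u \<in> S" "u \<in> D" "w \<in> S" "w \<notin> D" "adj u w"
      by (rule conn_cut)
    have "w \<in> nb D" by (rule nbI[OF uw(2,5,4)])
    then have "proper_tube V E D" unfolding proper_tube_iff using D(1-3) bS(2) by auto
    moreover have "compatible_tubes E D T" if T: "T \<in> R" for T
    proof -
      have bT: "T \<subseteq> V" "conn T" using block[of T] T by auto
      consider "T \<subset> S" | "S \<subseteq> T" | "T \<inter> S = {}" "\<not> (\<exists>u\<in>T. \<exists>v\<in>S. adj u v)"
      proof (cases "S \<in> R")
        case True
        from tubing_compatible[OF reference_tubing T True] that show ?thesis
          unfolding compatible_tubes_def by blast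
      next
        case False
        with S have K: "S \<in> comps" by blast
        show ?thesis
        proof (cases "T \<inter> S = {}")
          case True
          moreover have "\<not> (\<exists>u\<in>T. \<exists>v\<in>S. adj u v)"
            using True K nbI[of _ S] adj_sym unfolding mem_comps_iff by blast
          ultimately show ?thesis by (rule that(3))
        next
          case False
          then have "T \<subseteq> S" using subset_component[OF K bT(2)] bT(1) by blast
          with that(1,2) show ?thesis by blast
        qed
      qed
      then show ?thesis
      proof cases
        case 1
        then have TU: "T \<subseteq> ?U" using r_notin[OF T] by blast
        show ?thesis
        proof (cases "T \<inter> D = {}")
          case True
          with D(4) TU have "\<not> (\<exists>u\<in>D. \<exists>v\<in>T. adj u v)" by blast
          with True show ?thesis unfolding compatible_tubes_def by blast
        next
          case False
          have "T \<subseteq> D" using conn_subset[OF bT(2) TU False D(4)] .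
          then show ?thesis unfolding compatible_tubes_def by blast
        qed
      next
        case 2
        with D(1) show ?thesis unfolding compatible_tubes_def by blast
      next
        case 3
        with D(1) have "D \<inter> T = {}" "\<not> (\<exists>u\<in>D. \<exists>v\<in>T. adj u v)" using adj_sym by blast+
        then show ?thesis unfolding compatible_tubes_def by blast
      qed
    qed
    ultimately have "D \<in> R" by (rule reference_maximal)
    with D have "D \<in> \<D>" unfolding \<D>_def by blast
    with D(2) show ?thesis by blast
  qed
  show ?thesis
  proof
    show "\<D> \<subseteq> R" using D(3) by blast
    show "S = insert r (\<Union>\<D>)" "r \<notin> \<Union>\<D>" using cover D(4) r(1) by blast+
    have "D \<inter> D' = {}" if "D \<in> \<D>" "D' \<in> \<D>" "D \<noteq> D'" for D D'
    proof (rule ccontr)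
      assume ne: "D \<inter> D' \<noteq> {}"
      have "D \<subseteq> D'" using conn_subset[OF D(2,4)[OF that(1)] ne D(5)[OF that(2)]] .
      moreover have "D' \<subseteq> D"
        using conn_subset[OF D(2,4)[OF that(2)] _ D(5)[OF that(1)]] ne by blast
      ultimately show False using that(3) by blast
    qed
    then have disj: "disjoint \<D>" by (rule disjointI)
    have "nb D \<inter> D' = {}" if "D \<in> \<D>" "D' \<in> \<D>" for D D'
      using D(5)[OF that(1)] D(4)[OF that(2)] unfolding nb_def by blast
    with disj show "separated \<D>" unfolding separated_def by blast
    show "\<forall>D\<in>\<D>. r \<in> nb D \<and> nb D \<subseteq> insert r (nb S)"
    proof (intro ballI conjI subsetI)
      fix D assume D': "D \<in> \<D>"
      have "S \<inter> D \<noteq> {}" "\<not> S \<subseteq> D" using D(1,4)[OF D'] r(1) by blast+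
      with bS(3) obtain u w where uw: "u \<in> S" "u \<in> D" "w \<in> S" "w \<notin> D" "adj u w" by (rule conn_cut)
      with D(5)[OF D'] have "w = r" by blast
      with uw nbI[of u D w] show "r \<in> nb D" by blast
      fix v assume "v \<in> nb D"
      with D(4,5)[OF D'] show "v \<in> insert r (nb S)" unfolding nb_def by blast
    qed
    show "\<forall>T\<in>R. T \<subset> S \<longrightarrow> (\<exists>D\<in>\<D>. T \<subseteq> D)"
    proof (intro ballI impI)
      fix T assume T: "T \<in> R" "T \<subset> S"
      then have TU: "T \<subseteq> ?U" using r_notin by blast
      have bT: "T \<noteq> {}" "conn T" using block[of T] T(1) by auto
      then obtain v where "v \<in> T" by blast
      with TU cover obtain D where D': "D \<in> \<D>" "v \<in> D" by blast
      with \<open>v \<in> T\<close> have "T \<inter> D \<noteq> {}" by blast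
      then have "T \<subseteq> D" by (rule conn_subset[OF bT(2) TU _ D(5)[OF D'(1)]])
      with D'(1) show "\<exists>D\<in>\<D>. T \<subseteq> D" by blast
    qed
  qed
qed

lemma components_separated: "separated comps"
proof -
  have "K \<inter> K' = {}" if "K \<in> comps" "K' \<in> comps" "K \<noteq> K'" for K K'
    using that subset_component[of K K'] subset_component[of K' K] unfolding mem_comps_iff by blast
  then have "disjoint comps" by (rule disjointI)
  moreover have "nb K = {}" if "K \<in> comps" for K using that unfolding mem_comps_iff by blast
  ultimately show ?thesis unfolding separated_def by simp
qed

lemma Union_components: "\<Union>comps = V"
proof
  show "\<Union>comps \<subseteq> V" using mem_comps_iff by blast
  show "V \<subseteq> \<Union>comps" by (meson UnionI component_containing subsetI)
qed

lemma finite_components: "finite comps"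
  by (rule finite_subset[of _ "Pow V"]) (use Union_components finite_V in auto)

text \<open>Induction along the forest: below \<open>S\<close> lie \<open>S\<close> itself and
  whatever lies below its child tubes, and likewise \<open>S\<close> has exactly one vertex, its
  root, besides those of the child tubes.\<close>

lemma card_block:
  assumes "S \<in> R \<union> comps"
  shows "card {T \<in> R \<union> comps. T \<subseteq> S} = card S"
  using assms
proof (induction "card S" arbitrary: S rule: less_induct)
  case less
  obtain r \<D> where D: "\<D> \<subseteq> R" "S = insert r (\<Union>\<D>)" "r \<notin> \<Union>\<D>" "separated \<D>"
    "\<forall>D\<in>\<D>. r \<in> nb D \<and> nb D \<subseteq> insert r (nb S)" "\<forall>T\<in>R. T \<subset> S \<longrightarrow> (\<exists>D\<in>\<D>. T \<subseteq> D)"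
    using block_root[OF less.prems] .
  note bS = block[OF less.prems]
  have sub: "D \<subset> S" if "D \<in> \<D>" for D using that D(2,3) by blast
  have fin: "finite \<D>" "finite (\<Union>\<D>)" using D(2) bS(4) by (auto intro: finite_UnionD)
  let ?B = "R \<union> comps"
  have inR: "T \<in> R" if T: "T \<in> ?B" "T \<subset> S" for T
  proof (rule ccontr)
    assume "T \<notin> R"
    with T(1) have "T \<in> comps" by blast
    then have "S \<subseteq> T" using subset_component[of T S] bS T(2) block(1)[OF T(1)] by blast
    with T(2) show False by blast
  qed
  have "{T \<in> ?B. T \<subseteq> S} = insert S (\<Union>D\<in>\<D>. {T \<in> ?B. T \<subseteq> D})"
  proof (intro equalityI subsetI)
    fix T assume T: "T \<in> {T \<in> ?B. T \<subseteq> S}"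
    show "T \<in> insert S (\<Union>D\<in>\<D>. {T \<in> ?B. T \<subseteq> D})"
    proof (cases "T = S")
      case False
      with T have T': "T \<in> ?B" "T \<subset> S" by auto
      then obtain D where "D \<in> \<D>" "T \<subseteq> D" using bspec[OF D(6) inR[OF T']] by auto
      then show ?thesis using T'(1) by (intro insertI2 UN_I[of D]) simp_all
    qed simp
  next
    fix T assume "T \<in> insert S (\<Union>D\<in>\<D>. {T \<in> ?B. T \<subseteq> D})"
    then consider "T = S" | D where "D \<in> \<D>" "T \<in> ?B" "T \<subseteq> D" by auto
    then show "T \<in> {T \<in> ?B. T \<subseteq> S}"
      by cases (use less.prems sub in auto)
  qed
  moreover have "S \<notin> (\<Union>D\<in>\<D>. {T \<in> ?B. T \<subseteq> D})" using sub by blast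
  moreover have "finite (\<Union>D\<in>\<D>. {T \<in> ?B. T \<subseteq> D})"
    by (rule finite_subset[of _ "Pow S"]) (use sub bS(4) in auto)
  moreover have "card (\<Union>D\<in>\<D>. {T \<in> ?B. T \<subseteq> D}) = card (\<Union>\<D>)"
  proof (rule card_subsets_of_disjoint_family)
    show "finite \<D>" by (rule fin(1))
    show "finite D" if "D \<in> \<D>" for D using sub[OF that] bS(4) finite_subset by blast
    show "disjoint \<D>" using D(4) unfolding separated_def by blast
    show "{} \<notin> ?B" using block(1) by blast
    show "card {T \<in> ?B. T \<subseteq> D} = card D" if "D \<in> \<D>" for D
      using that D(1) less.hyps[of D] psubset_card_mono[OF bS(4) sub[OF that]] by blast
  qed
  ultimately have "card {T \<in> ?B. T \<subseteq> S} = Suc (card (\<Union>\<D>))" by simp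
  also have "\<dots> = card S" using D(2,3) fin(2) by simp
  finally show ?case .
qed

text \<open>Summing \<open>card_block\<close> over the components counts as many blocks as vertices;
  the components themselves are then taken off.\<close>

lemma card_reference: "card R = card V - card comps"
proof -
  let ?B = "R \<union> comps"
  have "?B = (\<Union>K\<in>comps. {T \<in> ?B. T \<subseteq> K})"
  proof (intro equalityI subsetI)
    fix T assume T: "T \<in> ?B"
    note bT = block[OF T]
    then obtain v where v: "v \<in> T" "v \<in> V" by blast
    obtain K where K: "K \<in> comps" "v \<in> K" using component_containing[OF v(2)] .
    then have "T \<subseteq> K" using subset_component[OF K(1) bT(3) _ bT(2)] v(1) by blast
    with K(1) T show "T \<in> (\<Union>K\<in>comps. {T \<in> ?B. T \<subseteq> K})" by blast
  qed blast
  then have "card ?B = card (\<Union>K\<in>comps. {T \<in> ?B. T \<subseteq> K})" by (rule arg_cong)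
  also have "\<dots> = card (\<Union>comps)"
  proof (rule card_subsets_of_disjoint_family)
    show "finite comps" by (rule finite_components)
    show "finite D" if "D \<in> comps" for D using that block(4) by blast
    show "disjoint comps" using components_separated unfolding separated_def by blast
    show "{} \<notin> ?B" using block(1) by blast
    show "card {T \<in> ?B. T \<subseteq> D} = card D" if "D \<in> comps" for D
      using that by (intro card_block) blast
  qed
  finally have "card ?B = card V" unfolding Union_components .
  moreover have "R \<inter> comps = {}"
    using tubing_proper[OF reference_tubing] unfolding proper_tube_def by blast
  then have "card ?B = card R + card comps"
    using tubing_finite[OF reference_tubing] finite_components by (intro card_Un_disjoint)
  ultimately show ?thesis by simp
qed

section \<open>Existence and uniqueness of functions with prescribed coordinates\<close>

text \<open>Only tubes strictly inside \<open>S\<close> are constrained. The coordinate at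
  \<open>S\<close> depends on the values inside \<open>S\<close> only through their minimum
  \<open>M\<close>, so it is settled one level up, when \<open>M\<close> is chosen.\<close>

definition solves :: "('a set \<Rightarrow> real) \<Rightarrow> 'a set \<Rightarrow> real \<Rightarrow> ('a \<Rightarrow> real) \<Rightarrow> bool" where
  "solves x S M f \<longleftrightarrow> Min (f ` S) = M \<and> (\<forall>T\<in>R. T \<subset> S \<longrightarrow> coordinate T f = x T)"

text \<open>The coordinate of a tube inside \<open>D\<close> reads only values on \<open>D\<close>
  and \<open>nb D\<close>, and there the glued function agrees with the solution for
  \<open>D\<close>.\<close>

lemma glue_solutions:
  assumes sep: "separated \<D>"
    and ex: "\<And>D. D \<in> \<D> \<Longrightarrow> \<exists>f. (\<forall>v. v \<notin> D \<longrightarrow> f v = g v) \<and> solves x D (m D) f"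
  shows "\<exists>f. (\<forall>v. v \<notin> \<Union>\<D> \<longrightarrow> f v = g v) \<and> (\<forall>D\<in>\<D>. solves x D (m D) f)"
proof -
  have "\<forall>D\<in>\<D>. \<exists>f. (\<forall>v. v \<notin> D \<longrightarrow> f v = g v) \<and> solves x D (m D) f" using ex by blast
  from bchoice[OF this] obtain F where
    F: "\<forall>D\<in>\<D>. (\<forall>v. v \<notin> D \<longrightarrow> F D v = g v) \<and> solves x D (m D) (F D)" ..
  define f where "f v = (if v \<in> \<Union>\<D> then F (THE D. D \<in> \<D> \<and> v \<in> D) v else g v)" for v
  have f: "f v = F D v" if "D \<in> \<D>" "v \<in> D" for D v
  proof -
    have "(THE D. D \<in> \<D> \<and> v \<in> D) = D"
    proof (rule the_equality)
      fix D' assume "D' \<in> \<D> \<and> v \<in> D'"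
      then show "D' = D" using that sep disjointD[of \<D> D' D] unfolding separated_def by blast
    qed (use that in blast)
    then show ?thesis unfolding f_def using that by auto
  qed
  \<comment> \<open>No member meets \<open>nb D\<close>, so both functions keep the outer value
    \<open>g v\<close> there.\<close>
  have f_nb: "f v = F D v" if "D \<in> \<D>" "v \<in> nb D" for D v
  proof -
    have "v \<notin> \<Union>\<D>" using that sep unfolding separated_def by blast
    moreover have "v \<notin> D" using that nb_disjoint by blast
    ultimately show ?thesis using F that(1) unfolding f_def by simp
  qed
  have "solves x D (m D) f" if D: "D \<in> \<D>" for D
    unfolding solves_def
  proof (intro conjI ballI impI)
    have FD: "solves x D (m D) (F D)" using F D by blast
    have "f ` D = F D ` D" using f[OF D] by (intro image_cong) auto
    with FD show "Min (f ` D) = m D" unfolding solves_def by simp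
    fix T assume T: "T \<in> R" "T \<subset> D"
    have "coordinate T f = coordinate T (F D)"
    proof (rule coordinate_cong)
      fix v assume "v \<in> T \<union> nb T"
      then have "v \<in> D \<or> v \<in> nb D" using T(2) unfolding nb_def by blast
      with f[OF D] f_nb[OF D] show "f v = F D v" by blast
    qed
    with FD T show "coordinate T f = x T" unfolding solves_def by simp
  qed
  moreover have "\<forall>v. v \<notin> \<Union>\<D> \<longrightarrow> f v = g v" unfolding f_def by simp
  ultimately show ?thesis by blast
qed

text \<open>Proceeds from the root downwards: \<open>root_value\<close> dictates the value at
  \<open>r\<close>, \<open>psi_surj\<close> then gives the minima over the child tubes, and the
  induction hypothesis fills these with the updated function \<open>h\<close> as outer
  values.\<close>

lemma solution_exists:
  assumes "S \<in> R \<union> comps"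
  shows "\<exists>f. (\<forall>v. v \<notin> S \<longrightarrow> f v = g v) \<and> solves x S M f"
  using assms
proof (induction "card S" arbitrary: S g M rule: less_induct)
  case less
  obtain r \<D> where D: "\<D> \<subseteq> R" "S = insert r (\<Union>\<D>)" "r \<notin> \<Union>\<D>" "separated \<D>"
    "\<forall>D\<in>\<D>. r \<in> nb D \<and> nb D \<subseteq> insert r (nb S)" "\<forall>T\<in>R. T \<subset> S \<longrightarrow> (\<exists>D\<in>\<D>. T \<subseteq> D)"
    using block_root[OF less.prems] .
  note bS = block[OF less.prems]
  have sub: "D \<subset> S" if "D \<in> \<D>" for D using that D(2,3) by blast
  have finD: "finite \<D>" using D(2) bS(4) by (auto intro: finite_UnionD)
  have ne: "{} \<notin> \<D>" using D(1) block(1) by blast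
  let ?thr = "\<lambda>g D. M + x D - (\<Sum>v\<in>nb D - {r}. max 0 (g v - M))"
  \<comment> \<open>Not circular: the neighbours of a child tube other than \<open>r\<close> lie in
    \<open>nb S\<close>, where the values of \<open>g\<close> are kept.\<close>
  define b where "b = Max (insert M (?thr g ` \<D>))"
  define h where "h = g(r := b)"
  have "\<exists>m. psi (nb D) h m = x D" if "D \<in> \<D>" for D
  proof -
    have "nb D \<noteq> {}" using D(5) that by blast
    then show ?thesis by (rule psi_surj[OF finite_nb]) blast
  qed
  then have "\<forall>D\<in>\<D>. \<exists>m. psi (nb D) h m = x D" by blast
  from bchoice[OF this] obtain m where m: "\<forall>D\<in>\<D>. psi (nb D) h (m D) = x D" ..
  have "\<exists>f. (\<forall>v. v \<notin> \<Union>\<D> \<longrightarrow> f v = h v) \<and> (\<forall>D\<in>\<D>. solves x D (m D) f)"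
  proof (rule glue_solutions[OF D(4)])
    fix D assume D': "D \<in> \<D>"
    then show "\<exists>f. (\<forall>v. v \<notin> D \<longrightarrow> f v = h v) \<and> solves x D (m D) f"
      using less.hyps[of D h "m D"] psubset_card_mono[OF bS(4) sub[OF D']] D(1) by blast
  qed
  then obtain f where f: "\<forall>v. v \<notin> \<Union>\<D> \<longrightarrow> f v = h v" "\<forall>D\<in>\<D>. solves x D (m D) f" by blast
  have f_nb: "f v = h v" if "D \<in> \<D>" "v \<in> nb D" for D v
  proof -
    have "v \<notin> \<Union>\<D>" using that D(4) unfolding separated_def by blast
    with f(1) show ?thesis by blast
  qed
  \<comment> \<open>The sum omits \<open>r\<close>, the only place where \<open>h\<close> and
    \<open>g\<close> can differ.\<close>
  have "?thr h D = ?thr g D" for D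
    by (auto simp: h_def intro!: sum.cong)
  then have "h r = Max (insert M (?thr h ` \<D>))" unfolding h_def b_def by simp
  then have "M \<le> h r \<and> (\<forall>D\<in>\<D>. M \<le> m D) \<and> (h r = M \<or> (\<exists>D\<in>\<D>. m D = M))"
    using root_value[OF finD, of nb r h m x M] finite_nb D(5) m by simp
  moreover have "f r = h r" using f(1) D(3) by blast
  moreover have "Min (f ` D) = m D" if "D \<in> \<D>" for D using f(2) that unfolding solves_def by blast
  ultimately have "Min (f ` S) = M"
    using Min_insert_Union_iff[OF D(2) bS(4) ne, of f M] by simp
  moreover have "coordinate T f = x T" if T: "T \<in> R" "T \<subset> S" for T
  proof -
    obtain D where D': "D \<in> \<D>" "T \<subseteq> D" using D(6) T by blast
    show ?thesis
    proof (cases "T = D")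
      case True
      have "Min (f ` D) = m D" using f(2) D'(1) unfolding solves_def by simp
      moreover have "psi (nb D) f (m D) = psi (nb D) h (m D)"
        by (rule psi_cong) (rule f_nb[OF D'(1)])
      ultimately show ?thesis unfolding coordinate_def True using m D'(1) by simp
    next
      case False
      with D' f(2) T show ?thesis unfolding solves_def by blast
    qed
  qed
  moreover have "f v = g v" if "v \<notin> S" for v
    using that f(1) D(2) unfolding h_def by auto
  ultimately show ?case unfolding solves_def by blast
qed

text \<open>The formula of \<open>root_value\<close> involves only the minimum \<open>M\<close> and
  values on \<open>nb S\<close>, so the two functions agree at \<open>r\<close>. They then agree
  around each child tube, and the induction descends once the minima over that tube are known to be
  equal.\<close>

lemma solution_unique:
  assumes "S \<in> R \<union> comps" "solves x S M f" "solves x S M g" "\<And>v. v \<in> nb S \<Longrightarrow> f v = g v" "v \<in> S"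
  shows "f v = g v"
  using assms
proof (induction "card S" arbitrary: S M v rule: less_induct)
  case less
  obtain r \<D> where D: "\<D> \<subseteq> R" "S = insert r (\<Union>\<D>)" "r \<notin> \<Union>\<D>" "separated \<D>"
    "\<forall>D\<in>\<D>. r \<in> nb D \<and> nb D \<subseteq> insert r (nb S)" "\<forall>T\<in>R. T \<subset> S \<longrightarrow> (\<exists>D\<in>\<D>. T \<subseteq> D)"
    using block_root[OF less.prems(1)] .
  note bS = block[OF less.prems(1)]
  have sub: "D \<subset> S" if "D \<in> \<D>" for D using that D(2,3) by blast
  have finD: "finite \<D>" using D(2) bS(4) by (auto intro: finite_UnionD)
  have ne: "{} \<notin> \<D>" using D(1) block(1) by blast
  let ?thr = "\<lambda>g D. M + x D - (\<Sum>v\<in>nb D - {r}. max 0 (g v - M))"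
  have root: "e r = Max (insert M (?thr e ` \<D>))" if e: "solves x S M e" for e
  proof -
    have psi: "psi (nb D) e (Min (e ` D)) = x D" if "D \<in> \<D>" for D
      using e sub[OF that] that D(1) unfolding solves_def coordinate_def by blast
    have "Min (e ` S) = M" using e unfolding solves_def by blast
    then have "M \<le> e r \<and> (\<forall>D\<in>\<D>. M \<le> Min (e ` D)) \<and> (e r = M \<or> (\<exists>D\<in>\<D>. Min (e ` D) = M))"
      unfolding Min_insert_Union_iff[OF D(2) bS(4) ne] .
    then show ?thesis
      using root_value[OF finD, of nb r e "\<lambda>D. Min (e ` D)" x M] finite_nb D(5) psi by simp
  qed
  have "?thr f D = ?thr g D" if "D \<in> \<D>" for D
  proof -
    have "f v = g v" if "v \<in> nb D - {r}" for v
      using that D(5) \<open>D \<in> \<D>\<close> by (intro less.prems(4)) blast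
    then show ?thesis by simp
  qed
  then have "?thr f ` \<D> = ?thr g ` \<D>" by (rule image_cong[OF refl])
  then have fr: "f r = g r" using root[OF less.prems(2)] root[OF less.prems(3)] by simp
  show ?case
  proof (cases "v = r")
    case False
    with less.prems(5) D(2) obtain D where D': "D \<in> \<D>" "v \<in> D" by blast
    have DR: "D \<in> R" using D(1) D'(1) by blast
    have nbD: "f u = g u" if "u \<in> nb D" for u
      using that D(5) D'(1) fr less.prems(4) by blast
    have eq: "coordinate D f = x D" "coordinate D g = x D"
      using less.prems(2,3) DR sub[OF D'(1)] unfolding solves_def by blast+
    \<comment> \<open>With equal values on \<open>nb D\<close>, both prescribed coordinates are
      values of one strictly decreasing function, so the minima coincide.\<close>
    have "psi (nb D) g (Min (f ` D)) = psi (nb D) f (Min (f ` D))"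
      using nbD by (intro psi_cong) simp
    then have "psi (nb D) g (Min (f ` D)) = psi (nb D) g (Min (g ` D))"
      using eq unfolding coordinate_def by simp
    moreover have "nb D \<noteq> {}" using D(5) D'(1) by blast
    ultimately have "Min (f ` D) = Min (g ` D)"
      using psi_le_iff[OF finite_nb] by (metis order.antisym order.refl)
    then have "solves x D (Min (f ` D)) f" "solves x D (Min (f ` D)) g"
      using less.prems(2,3) sub[OF D'(1)] unfolding solves_def by auto
    then show ?thesis
      using less.hyps[of D] psubset_card_mono[OF bS(4) sub[OF D'(1)]] DR nbD D'(2) by blast
  qed (use fr in simp)
qed

end

section \<open>The bijection between positively weighted tubings and coordinate vectors\<close>

context reference_tubing
begin

lemma reference_in_component:
  assumes "S \<in> R"
  obtains K where "K \<in> comps" "S \<subset> K"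
proof -
  have S: "S \<noteq> {}" "S \<subseteq> V" "conn S" using block[of S] assms by auto
  then obtain v where v: "v \<in> S" "v \<in> V" by blast
  obtain K where K: "K \<in> comps" "v \<in> K" using component_containing[OF v(2)] .
  then have "S \<inter> K \<noteq> {}" using v(1) by blast
  then have "S \<subseteq> K" using subset_component[OF K(1) S(3)] S(2) by blast
  moreover have "S \<noteq> K"
    using tubing_proper[OF reference_tubing assms] K(1) unfolding proper_tube_def by blast
  ultimately show ?thesis using K(1) that by blast
qed

text \<open>On each component both heights have minimum 0 and solve the same system with no outer
  neighbours, so they coincide on \<open>V\<close>; \<open>height_gap\<close> then reads off the
  tubes and their weights.\<close>

lemma tubing_determined_by_coordinates:
  assumes A: "tubing V E \<A>" "\<And>T. T \<in> \<A> \<Longrightarrow> 0 < c T"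
    and B: "tubing V E \<B>" "\<And>T. T \<in> \<B> \<Longrightarrow> 0 < e T"
    and eq: "\<And>S. S \<in> R \<Longrightarrow> coordinate S (height \<A> c) = coordinate S (height \<B> e)"
  shows "\<A> = \<B> \<and> (\<forall>T\<in>\<A>. c T = e T)"
proof -
  let ?f = "height \<A> c" and ?g = "height \<B> e"
  have c: "0 \<le> c T" if "T \<in> \<A>" for T using A(2)[OF that] by simp
  have e: "0 \<le> e T" if "T \<in> \<B>" for T using B(2)[OF that] by simp
  have fg: "?f v = ?g v" if v: "v \<in> V" for v
  proof -
    obtain K where K: "K \<in> comps" "v \<in> K" using component_containing[OF v] .
    have sf: "solves (\<lambda>S. coordinate S ?f) K 0 ?f"
      unfolding solves_def using height_zero_on_component[OF A(1) c K(1)] by simp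
    have sg: "solves (\<lambda>S. coordinate S ?f) K 0 ?g"
      unfolding solves_def using height_zero_on_component[OF B(1) e K(1)] eq by simp
    have "nb K = {}" using K(1) unfolding mem_comps_iff by blast
    then show ?thesis by - (rule solution_unique[OF _ sf sg _ K(2)], use K(1) in simp_all)
  qed
  have gap: "(if S \<in> \<A> then c S else 0) = (if S \<in> \<B> then e S else 0)" if S: "proper_tube V E S" for S
  proof -
    have "S \<subseteq> V" using S unfolding proper_tube_iff by blast
    then have "?f ` S = ?g ` S" "?f ` nb S = ?g ` nb S"
      using fg nb_subset[of S] by (auto intro!: image_cong)
    then show ?thesis
      using height_gap[where c = c, OF A(1) c S] height_gap[where c = e, OF B(1) e S] by simp
  qed
  have AB: "T \<in> \<B>" "c T = e T" if T: "T \<in> \<A>" for T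
    using gap[OF tubing_proper[OF A(1) T]] A(2)[OF T] T by (auto split: if_splits)
  have "T \<in> \<A>" if T: "T \<in> \<B>" for T
    using gap[OF tubing_proper[OF B(1) T]] B(2)[OF T] T by (auto split: if_splits)
  with AB show ?thesis by blast
qed

text \<open>Solutions with minimum 0 on each component are glued. The result is nonnegative with a
  zero on every component, hence a height function by \<open>tubing_decomposition\<close>.\<close>

lemma tubing_with_coordinates:
  obtains \<T> c where "tubing V E \<T>" "\<And>T. T \<in> \<T> \<Longrightarrow> 0 < c T"
    "\<And>S. S \<in> R \<Longrightarrow> coordinate S (height \<T> c) = x S"
proof -
  have "\<exists>f. (\<forall>v. v \<notin> \<Union>comps \<longrightarrow> f v = 0) \<and> (\<forall>K\<in>comps. solves x K 0 f)"
    by (intro glue_solutions[OF components_separated] solution_exists) blast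
  then obtain f where f: "\<And>K. K \<in> comps \<Longrightarrow> solves x K 0 f" by blast
  have K: "finite K" "K \<noteq> {}" "Min (f ` K) = 0" if "K \<in> comps" for K
    using block[of K] f[OF that] that unfolding solves_def by auto
  have "0 \<le> f v" if v: "v \<in> V" for v
  proof -
    obtain K' where K': "K' \<in> comps" "v \<in> K'" using component_containing[OF v] .
    then have "Min (f ` K') \<le> f v" using K(1) by simp
    then show ?thesis using K(3)[OF K'(1)] by simp
  qed
  moreover have "\<exists>v\<in>K'. f v = 0" if K': "K' \<in> comps" for K'
  proof -
    have "Min (f ` K') \<in> f ` K'" using K(1,2)[OF K'] by (intro Min_in) auto
    then show ?thesis using K(3)[OF K'] by auto
  qed
  ultimately obtain \<T> c where T: "tubing V E \<T>" "\<forall>T\<in>\<T>. 0 < c T" "\<forall>v\<in>V. f v = height \<T> c v"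
    using tubing_decomposition[of f] by blast
  have "coordinate S (height \<T> c) = x S" if S: "S \<in> R" for S
  proof -
    have "S \<subseteq> V" using block[of S] S by blast
    then have "coordinate S (height \<T> c) = coordinate S f"
      using T(3) nb_subset[of S] by (intro coordinate_cong) auto
    moreover obtain K' where "K' \<in> comps" "S \<subset> K'" using reference_in_component[OF S] .
    ultimately show ?thesis using f S unfolding solves_def by auto
  qed
  with T(1,2) that show ?thesis by blast
qed

end

section \<open>The compatibility fan\<close>

lemma lookup_scaleR: "Poly_Mapping.lookup (r *\<^sub>R x) i = r *\<^sub>R Poly_Mapping.lookup x i"
proof -
  have "finite {i. r *\<^sub>R Poly_Mapping.lookup x i \<noteq> 0}"
    by (rule finite_subset[OF _ finite_keys[of x]]) (auto simp: in_keys_iff)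
  then show ?thesis unfolding scaleR_poly_mapping_def by (simp add: lookup_Abs_poly_mapping)
qed

lemma lookup_compatibility_vector:
  "Poly_Mapping.lookup (compatibility_vector E Ts T) i =
    (if i < length Ts then real_of_int (compatibility_degree E (Ts ! i) T) else 0)"
  unfolding compatibility_vector_def by (simp add: lookup_sum lookup_single when_def)

theorem theorem3p6:
  fixes V :: "'a set" and E :: "'a set set" and Ts :: "'a set list" and n :: nat
  assumes "finite_simple_graph V E"
    and "n = card V - card (components_of_graph V E)"
    and "distinct Ts"
    and "maximal_tubing V E (set Ts)"
  shows "(\<forall>\<T>. tubing V E \<T> \<longrightarrow>
            inj_on (compatibility_vector E Ts) \<T> \<and>
            independent (compatibility_vector E Ts ` \<T>)) \<and>
         complete_simplicial_fan (coordinate_space n) (compatibility_fan V E Ts) \<and>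
         poset_isomorphism (compatibility_cone E Ts)
           (nested_complex V E) (\<subseteq>) (compatibility_fan V E Ts) (face_of)"
proof -
  interpret reference_tubing V E "set Ts"
    using assms(1,4) by unfold_locales
  \<comment> \<open>The length of the list is the dimension because of the count of tubes in a
    maximal tubing.\<close>
  have n: "n = length Ts"
    using card_reference assms(2) distinct_card[OF assms(3)] by simp
  let ?d = "compatibility_vector E Ts"
  \<comment> \<open>Translates vector equations into equations between piecewise linear coordinates
    of heights.\<close>
  have lookup: "Poly_Mapping.lookup (\<Sum>T\<in>\<T>. c T *\<^sub>R ?d T) i =
      (if i < n then coordinate (Ts ! i) (height \<T> c) else 0)"
    if \<T>: "tubing V E \<T>" "\<And>T. T \<in> \<T> \<Longrightarrow> 0 < c T" for \<T> c i
  proof (cases "i < n")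
    case True
    then have "proper_tube V E (Ts ! i)"
      using n by (intro tubing_proper[OF reference_tubing]) simp
    then have "coordinate (Ts ! i) (height \<T> c) =
        (\<Sum>T\<in>\<T>. c T * real_of_int (compatibility_degree E (Ts ! i) T))"
      using \<T> by (intro coordinate_height) (auto simp: less_imp_le)
    then show ?thesis
      using True n by (simp add: lookup_sum lookup_scaleR lookup_compatibility_vector)
  qed (use n in \<open>simp add: lookup_sum lookup_scaleR lookup_compatibility_vector\<close>)
  interpret unique_positive_representation "nested_complex V E" ?d "coordinate_space n"
  proof
    show "finite (nested_complex V E)"
    proof (rule finite_subset)
      show "nested_complex V E \<subseteq> Pow (Pow V)"
        unfolding nested_complex_def tubing_def proper_tube_iff by blast
    qed (use finite_V in simp)
    show "finite A" if "A \<in> nested_complex V E" for A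
      using that tubing_finite unfolding nested_complex_def by simp
    show "B \<in> nested_complex V E" if "A \<in> nested_complex V E" "B \<subseteq> A" for A B
      using that tubing_subset unfolding nested_complex_def by simp
    show "A = B \<and> (\<forall>i\<in>A. c i = e i)"
      if AB: "A \<in> nested_complex V E" "B \<in> nested_complex V E"
        "\<And>i. i \<in> A \<Longrightarrow> 0 < c i" "\<And>i. i \<in> B \<Longrightarrow> 0 < e i"
        "(\<Sum>i\<in>A. c i *\<^sub>R ?d i) = (\<Sum>i\<in>B. e i *\<^sub>R ?d i)" for A B c e
    proof -
      have tub: "tubing V E A" "tubing V E B" using AB(1,2) unfolding nested_complex_def by auto
      have "coordinate S (height A c) = coordinate S (height B e)" if S: "S \<in> set Ts" for S
      proof -
        obtain i where "i < n" "S = Ts ! i" using S n by (metis in_set_conv_nth)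
        then show ?thesis
          using lookup[where c = c and i = i, OF tub(1) AB(3)] lookup[where c = e and i = i, OF tub(2) AB(4)] AB(5) by simp
      qed
      then show ?thesis by (intro tubing_determined_by_coordinates tub AB(3,4))
    qed
    show "x \<in> coordinate_space n \<longleftrightarrow>
      (\<exists>A\<in>nested_complex V E. \<exists>c. (\<forall>i\<in>A. 0 < c i) \<and> x = (\<Sum>i\<in>A. c i *\<^sub>R ?d i))" for x
    proof
      assume x: "x \<in> coordinate_space n"
      \<comment> \<open>The prescribed values are indexed by tubes while \<open>x\<close> is indexed
        by positions; since \<open>Ts\<close> is distinct, the inverse of \<open>(!) Ts\<close>
        converts one into the other.\<close>
      obtain \<T> c where T: "tubing V E \<T>" "\<And>T. T \<in> \<T> \<Longrightarrow> 0 < c T"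
        "\<And>S. S \<in> set Ts \<Longrightarrow> coordinate S (height \<T> c) =
          Poly_Mapping.lookup x (the_inv_into {..<n} ((!) Ts) S)"
        using tubing_with_coordinates[where x = "\<lambda>S. Poly_Mapping.lookup x (the_inv_into {..<n} ((!) Ts) S)"]
        by blast
      have "inj_on ((!) Ts) {..<n}"
        using assms(3) n by (intro inj_on_nth) auto
      then have inv: "the_inv_into {..<n} ((!) Ts) (Ts ! i) = i" if "i < n" for i
        using that by (intro the_inv_into_f_f) auto
      have "x = (\<Sum>T\<in>\<T>. c T *\<^sub>R ?d T)"
      proof (rule poly_mapping_eqI)
        fix i
        show "Poly_Mapping.lookup x i = Poly_Mapping.lookup (\<Sum>T\<in>\<T>. c T *\<^sub>R ?d T) i"
        proof (cases "i < n")
          case True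
          then have "Ts ! i \<in> set Ts" using n by simp
          then show ?thesis using lookup[where c = c and i = i, OF T(1,2)] T(3) inv[OF True] True by simp
        next
          case False
          then have "i \<notin> Poly_Mapping.keys x" using x unfolding coordinate_space_def by auto
          then show ?thesis using lookup[where c = c and i = i, OF T(1,2)] False by (simp add: in_keys_iff)
        qed
      qed
      with T(1,2) show "\<exists>A\<in>nested_complex V E. \<exists>c. (\<forall>i\<in>A. 0 < c i) \<and> x = (\<Sum>i\<in>A. c i *\<^sub>R ?d i)"
        unfolding nested_complex_def by (intro bexI[of _ \<T>] exI[of _ c]) simp_all
    next
      assume "\<exists>A\<in>nested_complex V E. \<exists>c. (\<forall>i\<in>A. 0 < c i) \<and> x = (\<Sum>i\<in>A. c i *\<^sub>R ?d i)"
      then obtain A c where A: "tubing V E A" "\<forall>i\<in>A. 0 < c i" and x: "x = (\<Sum>i\<in>A. c i *\<^sub>R ?d i)"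
        unfolding nested_complex_def by (elim bexE exE conjE) simp
      have "Poly_Mapping.lookup x i = 0" if "\<not> i < n" for i
        unfolding x using lookup[of A c i] A that by simp
      then show "x \<in> coordinate_space n"
        unfolding coordinate_space_def by (force simp: in_keys_iff)
    qed
  qed
  have cone: "compatibility_cone E Ts = ray_cone"
    by (rule ext) (simp add: compatibility_cone_def ray_cone_def)
  have fan: "compatibility_fan V E Ts = ray_cone ` nested_complex V E"
    unfolding compatibility_fan_def cone nested_complex_def by blast
  show ?thesis
    unfolding cone fan
    using inj_on_rays independent_rays complete_simplicial_fan_ray_cones poset_isomorphism_ray_cone
    unfolding nested_complex_def by blast
qed

end
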